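(* There exist $m_0\in\mathbb Z^+$ and $C>0$ such that, for every integer $m\ge m_0$ and $k=2\pi m\sqrt2$, the solution operator $y\mapsto\mathcal A^{-1}(k,y):L^2([0,2])\to L^2([0,2])$ (defined near $y=0$) cannot be analytically continued, as a function of $y$, to any ball $\{y\in\mathbb C:|y|<\rho\}$ with $\rho>C k^{-1}$.
   Context: For $k>0$ and $y\in\mathbb C$ consider the one-dimensional Helmholtz operator on $(0,\infty)$ $$P:=k^{-2}\partial_x^2+\Big(1-\big(\tfrac12+y\big)\mathbf 1_{[0,1]}(x)\Big),$$ with zero Dirichlet condition at $x=0$ and the outgoing condition $(k^{-1}\partial_x-\mathrm i)u|_{x=2}=0$ (equivalent to $u$ being a multiple of $\mathrm e^{\mathrm ikx}$ for large $x$). Let $\mathcal H:=\{v\in H^1(0,2):v(0)=0\}$, let $\mathcal H^*$ be its space of bounded antilinear functionals, and define $\mathcal A(k,y):\mathcal H\to\mathcal H^*$ by $$\langle\mathcal A(k,y)u,v\rangle:=\int_0^2\Big(k^{-2}u'\overline{v'}-\big(1-(\tfrac12+y)\mathbf 1_{[0,1]}\big)u\overline v\Big)\,dx-\mathrm i k^{-1}u(2)\overline{v(2)} .$$ The solution operator $\mathcal A^{-1}(k,y):L^2([0,2])\to L^2([0,2])$ maps $f$ to the solution $u\in\mathcal H$ of $\langle\mathcal A(k,y)u,v\rangle=\int_0^2f\overline v$ for all $v\in\mathcal H$, i.e. of $Pu=-f$ with the boundary conditions $u(0)=0$ and $(k^{-1}\partial_x-\mathrm i)u|_{x=2}=0$.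 It is well defined for $y$ near $0$. *)

theory Defs
  imports "HOL-Analysis.Analysis"
begin

abbreviation leb02 :: "real measure" where
  "leb02 \<equiv> lebesgue_on {0..2}"

definition square_int :: "(real \<Rightarrow> complex) \<Rightarrow> bool" where
  "square_int f \<longleftrightarrow> f \<in> borel_measurable leb02 \<and> integrable leb02 (\<lambda>x. (cmod (f x))\<^sup>2)"

lemma square_int_zero: "square_int (\<lambda>_. 0)"
  by (simp add: square_int_def)

lemma square_int_add:
  assumes "square_int f" "square_int g"
  shows "square_int (\<lambda>x. f x + g x)"
proof -
  have [measurable]: "f \<in> borel_measurable leb02" "g \<in> borel_measurable leb02"
    using assms by (auto simp: square_int_def)
  have "integrable leb02 (\<lambda>x. 2 * (cmod (f x))\<^sup>2 + 2 * (cmod (g x))\<^sup>2)"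
    using assms by (auto simp: square_int_def)
  moreover have "(cmod (f x + g x))\<^sup>2 \<le> 2 * (cmod (f x))\<^sup>2 + 2 * (cmod (g x))\<^sup>2" for x
  proof -
    have "(cmod (f x + g x))\<^sup>2 \<le> (cmod (f x) + cmod (g x))\<^sup>2"
      by (intro power_mono norm_triangle_ineq) auto
    also have "\<dots> \<le> 2 * (cmod (f x))\<^sup>2 + 2 * (cmod (g x))\<^sup>2"
      using sum_squares_bound[of "cmod (f x)" "cmod (g x)"] by (simp add: power2_sum)
    finally show ?thesis .
  qed
  ultimately have "integrable leb02 (\<lambda>x. (cmod (f x + g x))\<^sup>2)"
    by (elim Bochner_Integration.integrable_bound) auto
  then show ?thesis by (simp add: square_int_def)
qed

lemma square_int_cmult:
  assumes "square_int f"
  shows "square_int (\<lambda>x. c * f x)"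
  using assms by (auto simp: square_int_def norm_mult power_mult_distrib)

lemma square_int_inner:
  assumes "square_int f" "square_int g"
  shows "integrable leb02 (\<lambda>x. f x * cnj (g x))"
proof -
  have [measurable]: "f \<in> borel_measurable leb02" "g \<in> borel_measurable leb02"
    using assms by (auto simp: square_int_def)
  have cnj_meas: "(\<lambda>x. cnj (g x)) \<in> borel_measurable leb02"
    by (rule borel_measurable_continuous_on[where f = cnj]) (auto intro: continuous_intros)
  have "integrable leb02 (\<lambda>x. (cmod (f x))\<^sup>2 + (cmod (g x))\<^sup>2)"
    using assms by (auto simp: square_int_def)
  moreover have "cmod (f x * cnj (g x)) \<le> (cmod (f x))\<^sup>2 + (cmod (g x))\<^sup>2" for x
    using sum_squares_bound[of "cmod (f x)" "cmod (g x)"]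
      mult_nonneg_nonneg[OF norm_ge_zero norm_ge_zero, of "f x" "g x"]
    by (simp only: norm_mult complex_mod_cnj)
  ultimately show ?thesis
    using cnj_meas by (elim Bochner_Integration.integrable_bound) auto
qed

text \<open>
  The complex Hilbert space $L^2([0,2])$.  There is no library class of complex inner product
  spaces, so the norm comes from the \<open>real_inner\<close> structure given by the real part of
  \<open>cinner_L2\<close>.
\<close>

quotient_type L2 = "real \<Rightarrow> complex" / partial:
  "\<lambda>f g. square_int f \<and> square_int g \<and> (AE x in leb02. f x = g x)"
proof (rule part_equivpI)
  show "\<exists>f. square_int f \<and> square_int f \<and> (AE x in leb02. f x = f x)"
    using square_int_zero by auto
qed (auto simp: symp_def transp_def elim: AE_mp)

lift_definition cinner_L2 :: "L2 \<Rightarrow> L2 \<Rightarrow> complex" is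
  "\<lambda>f g. LINT x|leb02. f x * cnj (g x)"
proof -
  fix f f' g g' :: "real \<Rightarrow> complex"
  assume f: "square_int f \<and> square_int f' \<and> (AE x in leb02. f x = f' x)"
    and g: "square_int g \<and> square_int g' \<and> (AE x in leb02. g x = g' x)"
  have "AE x in leb02. f x * cnj (g x) = f' x * cnj (g' x)"
    using f g by (auto elim!: AE_mp)
  then show "(LINT x|leb02. f x * cnj (g x)) = (LINT x|leb02. f' x * cnj (g' x))"
    using square_int_inner f g
    by (intro integral_cong_AE) (auto dest!: borel_measurable_integrable)
qed

lift_definition scaleC_L2 :: "complex \<Rightarrow> L2 \<Rightarrow> L2" is "\<lambda>c f x. c * f x"
  by (auto simp: square_int_cmult)

instantiation L2 :: real_inner
begin

lift_definition zero_L2 :: L2 is "\<lambda>_. 0"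
  by (simp add: square_int_zero)

lift_definition plus_L2 :: "L2 \<Rightarrow> L2 \<Rightarrow> L2" is "\<lambda>f g x. f x + g x"
  by (auto simp: square_int_add elim!: AE_mp)

definition uminus_L2 :: "L2 \<Rightarrow> L2" where "- f = scaleC_L2 (-1) f"

definition minus_L2 :: "L2 \<Rightarrow> L2 \<Rightarrow> L2" where "f - g = f + (- g)" for f g :: L2

definition scaleR_L2 :: "real \<Rightarrow> L2 \<Rightarrow> L2" where "r *\<^sub>R f = scaleC_L2 (complex_of_real r) f"

definition inner_L2 :: "L2 \<Rightarrow> L2 \<Rightarrow> real" where "f \<bullet> g = Re (cinner_L2 f g)"

definition norm_L2 :: "L2 \<Rightarrow> real" where "norm f = sqrt (f \<bullet> f)" for f :: L2

definition dist_L2 :: "L2 \<Rightarrow> L2 \<Rightarrow> real" where "dist f g = norm (f - g)" for f g :: L2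

definition sgn_L2 :: "L2 \<Rightarrow> L2" where "sgn f = inverse (norm f) *\<^sub>R f" for f :: L2

definition uniformity_L2 :: "(L2 \<times> L2) filter" where
  "uniformity_L2 = (INF e\<in>{0<..}. principal {(f, g). dist f g < e})"

definition open_L2 :: "L2 set \<Rightarrow> bool" where
  "open_L2 U \<longleftrightarrow> (\<forall>f\<in>U. eventually (\<lambda>(f', g). f' = f \<longrightarrow> g \<in> U) uniformity)"

instance
proof
  fix f g h :: L2 and r s :: real and U :: "L2 set"
  show "f + g + h = f + (g + h)"
    by transfer (auto simp: square_int_add add.assoc)
  show comm: "f + g = g + f"
    by transfer (auto simp: square_int_add add.commute)
  show "0 + f = f"
    by transfer auto
  show "- f + f = 0"
    unfolding uminus_L2_def
    by transfer (auto simp: square_int_zero)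
  show "f - g = f + - g"
    by (rule minus_L2_def)
  show "r *\<^sub>R (f + g) = r *\<^sub>R f + r *\<^sub>R g"
    unfolding scaleR_L2_def
    by transfer (auto simp: square_int_add ring_distribs
        intro!: square_int_add square_int_cmult)
  show "(r + s) *\<^sub>R f = r *\<^sub>R f + s *\<^sub>R f"
    unfolding scaleR_L2_def
    by transfer (auto simp: ring_distribs intro!: square_int_add square_int_cmult)
  show "r *\<^sub>R s *\<^sub>R f = (r * s) *\<^sub>R f"
    unfolding scaleR_L2_def
    by transfer (auto simp: mult.assoc intro!: square_int_cmult)
  show "1 *\<^sub>R f = f"
    unfolding scaleR_L2_def by transfer auto
  show "dist f g = norm (f - g)"
    by (rule dist_L2_def)
  show "sgn f = inverse (norm f) *\<^sub>R f"
    by (rule sgn_L2_def)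
  show "(uniformity :: (L2 \<times> L2) filter) = (INF e\<in>{0<..}. principal {(f, g). dist f g < e})"
    by (rule uniformity_L2_def)
  show "open U \<longleftrightarrow> (\<forall>f\<in>U. \<forall>\<^sub>F (f', g) in uniformity. f' = f \<longrightarrow> g \<in> U)"
    by (rule open_L2_def)
  show "f \<bullet> g = g \<bullet> f"
    unfolding inner_L2_def
  proof transfer
    fix f g assume *: "square_int f \<and> square_int f \<and> (AE x in leb02. f x = f x)"
      "square_int g \<and> square_int g \<and> (AE x in leb02. g x = g x)"
    have "Re (LINT x|leb02. f x * cnj (g x)) = (LINT x|leb02. Re (f x * cnj (g x)))"
      using * by (intro integral_Re[symmetric] square_int_inner) auto
    also have "\<dots> = (LINT x|leb02. Re (g x * cnj (f x)))"
      by (simp add: mult.commute)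
    also have "\<dots> = Re (LINT x|leb02. g x * cnj (f x))"
      using * by (intro integral_Re square_int_inner) auto
    finally show "Re (LINT x|leb02. f x * cnj (g x)) = Re (LINT x|leb02. g x * cnj (f x))" .
  qed
  show "(f + g) \<bullet> h = f \<bullet> h + g \<bullet> h"
    unfolding inner_L2_def by transfer (auto simp: ring_distribs square_int_inner)
  show "(r *\<^sub>R f) \<bullet> g = r * (f \<bullet> g)"
    unfolding inner_L2_def scaleR_L2_def by transfer (simp add: mult.assoc)
  have sq: "Re (LINT x|leb02. f x * cnj (f x)) = (LINT x|leb02. (cmod (f x))\<^sup>2)" for f
    by (simp add: complex_norm_square[symmetric] flip: of_real_power)
  show "0 \<le> f \<bullet> f"
    unfolding inner_L2_def by transfer (simp add: sq)
  show "f \<bullet> f = 0 \<longleftrightarrow> f = 0"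
    unfolding inner_L2_def
    by transfer (auto simp: sq square_int_zero square_int_def integral_nonneg_eq_0_iff_AE)
  show "norm f = sqrt (f \<bullet> f)"
    by (rule norm_L2_def)
qed

end

lemma bounded_linear_scaleC_L2: "bounded_linear (scaleC_L2 c)"
proof (rule bounded_linear_intro[where K = "cmod c"])
  fix f g :: L2 and r :: real
  show "scaleC_L2 c (f + g) = scaleC_L2 c f + scaleC_L2 c g"
    by transfer (auto simp: ring_distribs intro!: square_int_add square_int_cmult)
  show "scaleC_L2 c (r *\<^sub>R f) = r *\<^sub>R scaleC_L2 c f"
    unfolding scaleR_L2_def
    by transfer (auto simp: mult.left_commute intro!: square_int_cmult)
  have "scaleC_L2 c f \<bullet> scaleC_L2 c f = (cmod c)\<^sup>2 * (f \<bullet> f)"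
    unfolding inner_L2_def
  proof transfer
    fix c :: complex and f :: "real \<Rightarrow> complex"
    have "(\<lambda>x. c * f x * cnj (c * f x)) = (\<lambda>x. complex_of_real ((cmod c)\<^sup>2) * (f x * cnj (f x)))"
      by (simp only: complex_norm_square complex_cnj_mult ac_simps)
    then show "Re (LINT x|leb02. c * f x * cnj (c * f x)) =
        (cmod c)\<^sup>2 * Re (LINT x|leb02. f x * cnj (f x))"
      by (simp only: integral_mult_right_zero) simp
  qed
  then show "norm (scaleC_L2 c f) \<le> norm f * cmod c"
    by (simp add: norm_L2_def real_sqrt_mult)
qed

lift_definition scaleC_op :: "complex \<Rightarrow> L2 \<Rightarrow>\<^sub>L L2" is scaleC_L2
  by (rule bounded_linear_scaleC_L2)

definition clinear_op :: "(L2 \<Rightarrow>\<^sub>L L2) \<Rightarrow> bool" where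
  "clinear_op T \<longleftrightarrow> (\<forall>c f. T (scaleC_L2 c f) = scaleC_L2 c (T f))"

text \<open>
  The library's \<open>holomorphic_on\<close> covers only scalar-valued functions.  As there, analyticity on an
  open set is complex differentiability at each of its points, here in the operator norm: the
  derivative at \<open>y\<close> is \<open>h \<mapsto> h D\<close> for a bounded operator \<open>D\<close>.  The library type of bounded operators
  is real-linear, so complex linearity of the values is required separately.
\<close>

definition op_analytic_on :: "(complex \<Rightarrow> L2 \<Rightarrow>\<^sub>L L2) \<Rightarrow> complex set \<Rightarrow> bool" where
  "op_analytic_on F S \<longleftrightarrow>
     (\<forall>y\<in>S. clinear_op (F y) \<and>
        (\<exists>D. clinear_op D \<and> (F has_derivative (\<lambda>h. scaleC_op h o\<^sub>L D)) (at y)))"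

text \<open>
  \<open>C\<^sub>c\<^sup>\<infinity>(0,2)\<close>: a closed support inside the open interval is bounded, hence compact.  Real-valued
  test functions suffice, since the defining identity of a weak derivative is complex linear in
  the test function.
\<close>

definition test_fun :: "(real \<Rightarrow> real) \<Rightarrow> bool" where
  "test_fun \<phi> \<longleftrightarrow>
     (\<forall>n x. (deriv ^^ n) \<phi> differentiable (at x)) \<and> closure {x. \<phi> x \<noteq> 0} \<subseteq> {0<..<2}"

definition has_weak_deriv :: "L2 \<Rightarrow> L2 \<Rightarrow> bool" where
  "has_weak_deriv u g \<longleftrightarrow>
     (\<forall>\<phi>. test_fun \<phi> \<longrightarrow>
        (LINT x|leb02. rep_L2 u x * of_real (deriv \<phi> x)) =
        - (LINT x|leb02. rep_L2 g x * of_real (\<phi> x)))"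

definition H1 :: "L2 set" where
  "H1 = {u. \<exists>g. has_weak_deriv u g}"

definition weak_deriv :: "L2 \<Rightarrow> L2" where
  "weak_deriv u = (THE g. has_weak_deriv u g)"

text \<open>Point values of an element of \<open>H1\<close> are those of its continuous representative on \<open>[0,2]\<close>.\<close>

definition point_val :: "L2 \<Rightarrow> real \<Rightarrow> complex" where
  "point_val u x =
     (THE z. \<exists>w. continuous_on {0..2} w \<and> (AE t in leb02. rep_L2 u t = w t) \<and> z = w x)"

definition H_space :: "L2 set" where
  "H_space = {u \<in> H1. point_val u 0 = 0}"

text \<open>
  The pairing $\langle\mathcal A(k,y)u,v\rangle$: the functional $\mathcal A(k,y)u \in \mathcal H^*$ is
  \<open>helmholtz_form k y u\<close> on \<open>H_space\<close>.  Only the values for \<open>u, v \<in> H_space\<close> are meaningful.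
\<close>

definition helmholtz_form :: "real \<Rightarrow> complex \<Rightarrow> L2 \<Rightarrow> L2 \<Rightarrow> complex" where
  "helmholtz_form k y u v =
     (LINT x|leb02.
        of_real (1 / k\<^sup>2) * rep_L2 (weak_deriv u) x * cnj (rep_L2 (weak_deriv v) x)
        - (1 - (1 / 2 + y) * indicator {0..1} x) * rep_L2 u x * cnj (rep_L2 v x))
     - \<i> * of_real (1 / k) * point_val u 2 * cnj (point_val v 2)"

definition is_solution :: "real \<Rightarrow> complex \<Rightarrow> L2 \<Rightarrow> L2 \<Rightarrow> bool" where
  "is_solution k y f u \<longleftrightarrow>
     u \<in> H_space \<and> (\<forall>v\<in>H_space. helmholtz_form k y u v = cinner_L2 f v)"

definition well_posed :: "real \<Rightarrow> complex \<Rightarrow> bool" where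
  "well_posed k y \<longleftrightarrow> (\<forall>f. \<exists>!u. is_solution k y f u)"

definition solution_op :: "real \<Rightarrow> complex \<Rightarrow> L2 \<Rightarrow> L2" where
  "solution_op k y f = (THE u. is_solution k y f u)"

text \<open>
  A continuation to the disc of radius \<open>\<rho>\<close> is an analytic family on the disc that agrees with the
  solution operator on some neighbourhood of \<open>0\<close>, which may depend on the family.
\<close>

definition continues_to_ball :: "real \<Rightarrow> real \<Rightarrow> bool" where
  "continues_to_ball k \<rho> \<longleftrightarrow>
     (\<exists>F. op_analytic_on F (ball 0 \<rho>) \<and>
        (\<forall>\<^sub>F y in nhds 0. blinfun_apply (F y) = solution_op k y))"

end

theory Submission
  imports Defs "HOL-Complex_Analysis.Complex_Analysis"
begin

text \<open>
  With $\kappa^2 = k^2(\frac12 - y)$, the outgoing solution of the homogeneous equation vanishes at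
  $0$ iff $\kappa\cos\kappa = \mathrm i k\sin\kappa$.  At $y = 0$ and $k = 2\pi m\sqrt 2$ one has
  $\kappa = 2\pi m$, which is not a root, so nearby problems are well posed: a Green function gives
  existence, and since the form is symmetric as a bilinear form, solving with datum $\overline{u-u'}$
  gives uniqueness.

  There is however a root with $|\kappa - 2\pi m| \le 4$ (by Brouwer's fixed point theorem), belonging to
  some $z = \frac12 - \kappa^2/k^2 = O(k^{-1})$.  Let $w$ be the corresponding resonant state.  Testing
  the equation for $u_y = \mathcal A^{-1}(k,y) f$ against $\overline w$ and moving all derivatives onto
  $w$ gives
  $$(y - z)\int_0^1 u_y w = \int_0^2 f w .$$
  An analytic continuation to a disc containing $z$ would satisfy this identity throughout; at $y = z$
  and $f = \overline w$ it says $\int |w|^2 = 0$.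
\<close>

section \<open>Smooth compactly supported functions\<close>

text \<open>Elements of \<open>H_space\<close> are classes of functions known only through test
  integrals, while the argument needs boundary values and integration by parts. Both come from
  showing that each such class contains an indefinite integral (\<open>h1_rep\<close>); the bump
  functions and the fundamental lemma serve this purpose. Since the datum is only square integrable
  and the coefficient jumps at 1, the differential equations too are read as integral identities
  (\<open>is_prim\<close>).

  The choice of k makes k / sqrt 2 a multiple of 2 \<pi>. Writing \<kappa> = 2 \<pi> m - i z removes
  m from exp(i \<kappa>) = exp z, and the resonance condition becomes tanh z = \<kappa> / k = 1 /
  sqrt 2 - i z / k. For z in a fixed ball and k large the right side stays in a fixed compact part
  of the open unit disc, so z can be sought in a ball whose radius does not depend on k; hence
  \<kappa>^2 / k^2 differs from 1/2 by O(1/k) only.\<close>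

definition smooth_fun :: "(real \<Rightarrow> real) \<Rightarrow> bool" where
  "smooth_fun f \<longleftrightarrow> (\<forall>n x. (deriv ^^ n) f differentiable (at x))"

lemma test_fun_iff: "test_fun \<phi> \<longleftrightarrow> smooth_fun \<phi> \<and> closure {x. \<phi> x \<noteq> 0} \<subseteq> {0<..<2}"
  by (simp add: test_fun_def smooth_fun_def)

text \<open>Coinduction: the derivative supplied by \<open>step\<close> must be
  \<open>deriv g\<close>, so \<open>P\<close> passes to all iterated derivatives. Smoothness thus
  reduces to finding a family closed under one differentiation, without formulas for the n-th
  derivative.\<close>

lemma smooth_fun_coinduct:
  assumes "P f"
    and step: "\<And>f. P f \<Longrightarrow> \<exists>f'. (\<forall>x. (f has_real_derivative f' x) (at x)) \<and> P f'"
  shows "smooth_fun f"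
proof -
  have d: "(\<forall>x. g differentiable (at x)) \<and> P (deriv g)" if P: "P g" for g
  proof -
    obtain g' where g': "\<And>x. (g has_real_derivative g' x) (at x)" "P g'"
      using step[OF P] by blast
    moreover have "deriv g = g'"
      using g'(1) by (auto intro: DERIV_imp_deriv)
    ultimately show ?thesis
      by (auto simp: real_differentiable_def)
  qed
  have "P ((deriv ^^ n) f)" for n
    by (induction n) (use assms(1) d in auto)
  then show ?thesis
    using d by (auto simp: smooth_fun_def)
qed

lemma smooth_fun_deriv: "smooth_fun f \<Longrightarrow> smooth_fun (deriv f)"
  unfolding smooth_fun_def by (metis comp_apply funpow_Suc_right)

lemma smooth_fun_DERIV: "smooth_fun f \<Longrightarrow> (f has_real_derivative deriv f x) (at x)"
  unfolding smooth_fun_def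
  by (metis DERIV_imp_deriv funpow_0 real_differentiable_def)

lemma smooth_fun_antideriv:
  assumes "\<And>x. (F has_real_derivative f x) (at x)" "smooth_fun f"
  shows "smooth_fun F"
  by (rule smooth_fun_coinduct[where P = "\<lambda>g. g = F \<or> smooth_fun g"])
     (use assms smooth_fun_deriv smooth_fun_DERIV in blast)+

text \<open>The algebra generated by smooth functions is closed under differentiation, so it consists of
  smooth functions; this avoids the Leibniz rule for higher derivatives.\<close>

inductive smooth_alg :: "(real \<Rightarrow> real) \<Rightarrow> bool" where
  base: "smooth_fun f \<Longrightarrow> smooth_alg f"
| add: "smooth_alg f \<Longrightarrow> smooth_alg g \<Longrightarrow> smooth_alg (\<lambda>x. f x + g x)"
| mult: "smooth_alg f \<Longrightarrow> smooth_alg g \<Longrightarrow> smooth_alg (\<lambda>x. f x * g x)"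

lemma smooth_alg_imp_smooth: "smooth_alg f \<Longrightarrow> smooth_fun f"
proof (rule smooth_fun_coinduct[where P = smooth_alg])
  show "\<exists>f'. (\<forall>x. (f has_real_derivative f' x) (at x)) \<and> smooth_alg f'" if "smooth_alg f" for f
    using that
  proof induction
    case (base f)
    then show ?case
      using smooth_fun_DERIV smooth_fun_deriv smooth_alg.base by blast
  next
    case (add f g)
    then show ?case
      using DERIV_add[where ?'a = real] smooth_alg.add by (elim exE conjE, intro exI conjI allI) blast+
  next
    case (mult f g)
    then obtain f' g' where *: "\<And>x. (f has_real_derivative f' x) (at x)" "smooth_alg f'"
      "\<And>x. (g has_real_derivative g' x) (at x)" "smooth_alg g'"
      by blast
    show ?case
      by (rule exI[of _ "\<lambda>x. f x * g' x + f' x * g x"])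
         (use * mult.hyps in \<open>auto intro!: smooth_alg.add smooth_alg.mult derivative_eq_intros\<close>)
  qed
qed

lemma smooth_fun_add: "smooth_fun f \<Longrightarrow> smooth_fun g \<Longrightarrow> smooth_fun (\<lambda>x. f x + g x)"
  and smooth_fun_mult: "smooth_fun f \<Longrightarrow> smooth_fun g \<Longrightarrow> smooth_fun (\<lambda>x. f x * g x)"
  by (auto intro!: smooth_alg_imp_smooth intro: smooth_alg.intros)

lemma smooth_fun_const: "smooth_fun (\<lambda>_. c)"
  by (rule smooth_fun_coinduct[where P = "\<lambda>f. \<exists>c. f = (\<lambda>_. c)"])
     (auto intro!: exI[of _ "\<lambda>_. 0"])

text \<open>The scalar \<open>e\<close> in the invariant collects the powers of \<open>c\<close>
  that the chain rule produces.\<close>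

lemma smooth_fun_affine:
  assumes "smooth_fun f"
  shows "smooth_fun (\<lambda>x. f (c * x + d))"
proof (rule smooth_fun_coinduct[where P = "\<lambda>h. \<exists>g e. smooth_fun g \<and> h = (\<lambda>x. e * g (c * x + d))"])
  show "\<exists>g e. smooth_fun g \<and> (\<lambda>x. f (c * x + d)) = (\<lambda>x. e * g (c * x + d))"
    by (rule exI[of _ f], rule exI[of _ 1]) (use assms in simp)
next
  fix h assume "\<exists>g e. smooth_fun g \<and> h = (\<lambda>x. e * g (c * x + d))"
  then obtain g e where g: "smooth_fun g" and h: "h = (\<lambda>x. e * g (c * x + d))"
    by blast
  have "(h has_real_derivative (e * c) * deriv g (c * x + d)) (at x)" for x
    unfolding h
    by (auto intro!: derivative_eq_intros DERIV_chain2[OF smooth_fun_DERIV[OF g]])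
  then show "\<exists>f'. (\<forall>x. (h has_real_derivative f' x) (at x)) \<and>
      (\<exists>g e. smooth_fun g \<and> f' = (\<lambda>x. e * g (c * x + d)))"
    using smooth_fun_deriv[OF g] by (intro exI[of _ "\<lambda>x. (e * c) * deriv g (c * x + d)"]) blast
qed

text \<open>The classical smooth function exp(-1/x), extended by 0, with polynomial factors in t =
  1/x. As d/dx = -t^2 d/dt, differentiation acts on the factor by p \<mapsto> t^2 (p - p'), so the
  family is closed under it.\<close>

definition flat :: "real poly \<Rightarrow> real \<Rightarrow> real" where
  "flat p x = (if x > 0 then poly p (1 / x) * exp (- (1 / x)) else 0)"

lemma poly_times_exp_tendsto_0: "((\<lambda>t. poly p t * exp (- t)) \<longlongrightarrow> 0) (at_top :: real filter)"
proof -
  have "((\<lambda>t. \<Sum>i\<le>degree p. coeff p i * (t ^ i / exp t)) \<longlongrightarrow> 0) (at_top :: real filter)"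
    by (intro tendsto_null_sum tendsto_mult_right_zero tendsto_power_div_exp_0)
  then show ?thesis
    by (simp add: poly_altdef exp_minus sum_distrib_right divide_inverse mult.assoc)
qed

lemma flat_DERIV: "(flat p has_real_derivative flat ([:0, 0, 1:] * (p - pderiv p)) x) (at x)"
proof (cases x "0::real" rule: linorder_cases)
  case less
  have "((\<lambda>_. 0) has_real_derivative 0) (at x)"
    by simp
  moreover have "\<forall>\<^sub>F y in nhds x. flat p y = 0"
    using less by (intro eventually_nhds_in_open[of "{..<0}", THEN eventually_mono]) (auto simp: flat_def)
  ultimately show ?thesis
    using less by (subst DERIV_cong_ev[OF refl _ refl]) (auto simp: flat_def)
next
  case greater
  have ev: "\<forall>\<^sub>F y in nhds x. flat p y = poly p (1 / y) * exp (- (1 / y))"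
    using greater by (intro eventually_nhds_in_open[of "{0<..}", THEN eventually_mono]) (auto simp: flat_def)
  have "((\<lambda>y. poly p (1 / y) * exp (- (1 / y))) has_real_derivative
      flat ([:0, 0, 1:] * (p - pderiv p)) x) (at x)"
    using greater
    by (auto intro!: derivative_eq_intros DERIV_chain2[OF poly_DERIV] 
        simp: flat_def divide_simps power2_eq_square algebra_simps)
  then show ?thesis
    by (subst DERIV_cong_ev[OF refl ev refl])
next
  case equal
  \<comment> \<open>At 0 the right difference quotient divides by y = 1/t; the factor
    \<open>[:0, 1:]\<close>, that is t, accounts for this division.\<close>
  have "((\<lambda>t. poly ([:0, 1:] * p) t * exp (- t)) \<longlongrightarrow> 0) (at_top :: real filter)"
    by (rule poly_times_exp_tendsto_0)
  then have "((\<lambda>y. poly ([:0, 1:] * p) (inverse y) * exp (- inverse y)) \<longlongrightarrow> 0) (at_right 0)"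
    by (rule filterlim_compose[OF _ filterlim_inverse_at_top_right])
  then have "((\<lambda>y. (flat p y - flat p 0) / (y - 0)) \<longlongrightarrow> 0) (at_right 0)"
    by (rule filterlim_cong[THEN iffD1, rotated -1])
       (auto simp: flat_def eventually_at_right_less divide_simps intro!: eventually_at_rightI[of 0 1])
  moreover have "((\<lambda>y. (flat p y - flat p 0) / (y - 0)) \<longlongrightarrow> 0) (at_left 0)"
    by (rule tendsto_eventually) (auto simp: flat_def intro!: eventually_at_leftI[of "-1" 0])
  ultimately show ?thesis
    unfolding equal has_field_derivative_iff by (simp add: filterlim_split_at_real flat_def)
qed

lemma smooth_fun_flat: "smooth_fun (flat p)"
  by (rule smooth_fun_coinduct[where P = "\<lambda>f. \<exists>p. f = flat p"]) (use flat_DERIV in blast)+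

text \<open>No plateau is built in: \<open>flat 1\<close> tends to 1 at infinity, so stretching by n
  already gives the indicator of the open interval in the limit. The shift by -1 keeps the support
  at distance 1/n from a and b, hence compact in (0,2) even for a = 0 and b = 2; for n = 0 the
  function is identically 0.\<close>

definition bump :: "nat \<Rightarrow> real \<Rightarrow> real \<Rightarrow> real \<Rightarrow> real" where
  "bump n a b x = flat 1 (real n * (x - a) - 1) * flat 1 (real n * (b - x) - 1)"

lemma flat_1_bounds: "0 \<le> flat 1 x" "flat 1 x \<le> 1"
  by (auto simp: flat_def)

lemma bump_bounds: "0 \<le> bump n a b x" "bump n a b x \<le> 1"
  by (auto simp: bump_def flat_1_bounds mult_le_one)

lemma flat_1_tendsto: "((flat 1) \<longlongrightarrow> 1) at_top"
proof -
  have "((\<lambda>x::real. exp (- (1 / x))) \<longlongrightarrow> exp (- 0)) at_top"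
    by (intro tendsto_intros tendsto_divide_0[OF tendsto_const] filterlim_at_top_imp_at_infinity filterlim_ident)
  moreover have "\<forall>\<^sub>F x in at_top. exp (- (1 / x)) = flat 1 x"
    using eventually_gt_at_top[of "0::real"] by eventually_elim (simp add: flat_def)
  ultimately show ?thesis
    using tendsto_cong by force
qed

lemma bump_tendsto: "(\<lambda>n. bump n a b x) \<longlonglongrightarrow> indicator {a<..<b} x"
proof (cases "a < x \<and> x < b")
  case True
  have "(\<lambda>n. flat 1 (real n * c - 1)) \<longlonglongrightarrow> 1" if "c > 0" for c
  proof -
    have "filterlim (\<lambda>n. c * real n - 1) at_top sequentially"
      using that by real_asymp
    then show ?thesis
      by (intro filterlim_compose[OF flat_1_tendsto]) (simp add: mult.commute)
  qed
  then show ?thesis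
    using True tendsto_mult[of "\<lambda>n. flat 1 (real n * (x - a) - 1)" 1 _ "\<lambda>n. flat 1 (real n * (b - x) - 1)" 1]
    by (simp add: bump_def)
next
  case False
  have "flat 1 (real n * c - 1) = 0" if "c \<le> 0" for n c
    using that mult_nonneg_nonpos[of "real n" c] by (simp add: flat_def)
  then have "bump n a b x = 0" for n
    using False by (cases "x \<le> a") (auto simp: bump_def)
  then show ?thesis
    using False by auto
qed

lemma bump_nonzero_imp:
  assumes "bump n a b x \<noteq> 0"
  shows "n > 0" "a + 1 / real n \<le> x" "x \<le> b - 1 / real n"
proof -
  have *: "real n * (x - a) > 1" "real n * (b - x) > 1"
    using assms by (auto simp: bump_def flat_def split: if_splits)
  show n: "n > 0"
    using *(1) by (cases n) auto
  show "a + 1 / real n \<le> x" "x \<le> b - 1 / real n"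
    using * n by (auto simp: field_simps)
qed

lemma test_fun_bump:
  assumes "0 \<le> a" "b \<le> 2"
  shows "test_fun (bump n a b)"
proof -
  have "smooth_fun (\<lambda>x. flat 1 (real n * x + (- real n * a - 1)) * flat 1 ((- real n) * x + (real n * b - 1)))"
    by (intro smooth_fun_mult smooth_fun_affine smooth_fun_flat)
  moreover have "(\<lambda>x. flat 1 (real n * x + (- real n * a - 1)) * flat 1 ((- real n) * x + (real n * b - 1))) = bump n a b"
    by (auto simp: bump_def algebra_simps)
  moreover have "closure {x. bump n a b x \<noteq> 0} \<subseteq> {0<..<2}"
  proof (cases "n = 0")
    case True
    then have "{x. bump n a b x \<noteq> 0} = {}"
      using bump_nonzero_imp(1) by blast
    then show ?thesis by simp
  next
    case False
    have "closure {x. bump n a b x \<noteq> 0} \<subseteq> {a + 1 / real n..b - 1 / real n}"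
      by (intro closure_minimal) (use bump_nonzero_imp in auto)
    also have "\<dots> \<subseteq> {a<..<b}"
    proof -
      have "1 / real n > 0"
        using False by simp
      then show ?thesis
        by (intro subsetI) (unfold atLeastAtMost_iff greaterThanLessThan_iff, linarith)
    qed
    also have "\<dots> \<subseteq> {0<..<2}"
      using assms by auto
    finally show ?thesis .
  qed
  ultimately show ?thesis
    by (simp add: test_fun_iff)
qed

section \<open>The fundamental lemma of the calculus of variations\<close>

lemma finite_measure_leb02: "finite_measure leb02"
  by (rule finite_measure_lebesgue_on) simp

lemma borel_measurable_leb02: "f \<in> borel_measurable borel \<Longrightarrow> f \<in> borel_measurable leb02"
  by (intro measurable_restrict_space1 measurable_completion) simp

lemma borel_measurable_indicator_leb02:
  "A \<in> sets borel \<Longrightarrow> indicat_real A \<in> borel_measurable leb02"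
  by (intro borel_measurable_leb02 borel_measurable_indicator)

lemma borel_measurable_leb02_continuous:
  "continuous_on {0..2} f \<Longrightarrow> f \<in> borel_measurable leb02"
  by (rule continuous_imp_measurable_on_sets_lebesgue) auto

lemma sets_leb02: "A \<in> sets borel \<Longrightarrow> A \<inter> {0..2} \<in> sets leb02"
  by (auto simp: sets_restrict_space)

lemma sets_leb02_atLeastAtMost: "0 \<le> a \<Longrightarrow> b \<le> 2 \<Longrightarrow> {a..b} \<in> sets leb02"
  using sets_leb02[of "{a..b}"] by (simp add: inf.absorb1)

lemma integrable_leb02_mult_bounded:
  fixes g m :: "real \<Rightarrow> complex"
  assumes "integrable leb02 g" "m \<in> borel_measurable leb02" "\<And>x. x \<in> {0..2} \<Longrightarrow> norm (m x) \<le> K"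
  shows "integrable leb02 (\<lambda>x. m x * g x)"
proof (rule Bochner_Integration.integrable_bound)
  show "integrable leb02 (\<lambda>x. K *\<^sub>R g x)"
    using assms by simp
  show "(\<lambda>x. m x * g x) \<in> borel_measurable leb02"
    using assms by measurable
  show "AE x in leb02. norm (m x * g x) \<le> norm (K *\<^sub>R g x)"
    using assms(3) by (intro AE_I2) (auto simp: norm_mult intro!: mult_right_mono order_trans[OF _ abs_ge_self])
qed

lemma integrable_leb02_mult_continuous:
  fixes g m :: "real \<Rightarrow> complex"
  assumes "integrable leb02 g" "continuous_on {0..2} m"
  shows "integrable leb02 (\<lambda>x. m x * g x)"
proof -
  have "bounded (m ` {0..2})"
    using assms(2) by (intro compact_imp_bounded compact_continuous_image) auto
  then obtain K where "\<And>x. x \<in> {0..2} \<Longrightarrow> norm (m x) \<le> K"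
    unfolding bounded_iff by blast
  then show ?thesis
    using assms borel_measurable_leb02_continuous by (intro integrable_leb02_mult_bounded)
qed

lemma integrable_leb02_continuous:
  fixes m :: "real \<Rightarrow> complex"
  assumes "continuous_on {0..2} m"
  shows "integrable leb02 m"
  using integrable_leb02_mult_continuous[of "\<lambda>_. 1", OF _ assms] by simp

lemma square_int_imp_integrable:
  assumes "square_int f"
  shows "integrable leb02 f"
proof -
  have "square_int (\<lambda>_. 1)"
    by (simp add: square_int_def)
  then show ?thesis
    using square_int_inner[OF assms] by fastforce
qed

text \<open>Dynkin's argument: open intervals are stable under intersection and generate the Borel
  sets, and the sets over which g integrates to 0 are closed under complements and countable
  disjoint unions.\<close>

lemma set_integral_zero_if_borel:
  fixes g :: "real \<Rightarrow> complex"
  assumes g: "integrable leb02 g"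
    and ivl: "\<And>a b. 0 \<le> a \<Longrightarrow> b \<le> 2 \<Longrightarrow> (LINT x|leb02. indicator {a<..<b} x *\<^sub>R g x) = 0"
    and A: "A \<in> sets borel"
  shows "(LINT x:A \<inter> {0..2}|leb02. g x) = 0"
proof -
  \<comment> \<open>The generators are arbitrary open intervals, while \<open>ivl\<close> covers
    only those inside [0,2]; after clipping, the two can differ only at the endpoints 0 and
    2.\<close>
  have ends: "AE x in leb02. x \<noteq> 0 \<and> x \<noteq> 2"
  proof -
    have "AE x in lebesgue. x \<noteq> (0::real) \<and> x \<noteq> 2"
      using AE_completion[OF AE_conjI[OF AE_lborel_singleton[of "0::real"] AE_lborel_singleton[of "2::real"]]] .
    then show ?thesis
      by (subst AE_restrict_space_iff) auto
  qed
  have open_ivl: "(LINT x:{a<..<b} \<inter> {0..2}|leb02. g x) = 0" for a b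
  proof -
    have "(LINT x:{a<..<b} \<inter> {0..2}|leb02. g x) =
        (LINT x|leb02. indicator {max a 0<..<min b 2} x *\<^sub>R g x)"
      unfolding set_lebesgue_integral_def
    proof (rule integral_cong_AE)
      show "AE x in leb02. indicat_real ({a<..<b} \<inter> {0..2}) x *\<^sub>R g x =
          indicat_real {max a 0<..<min b 2} x *\<^sub>R g x"
        using ends AE_space by eventually_elim (auto simp: indicator_def)
    qed (use g sets_leb02[of "{a<..<b}"]
        in \<open>auto intro!: borel_measurable_scaleR borel_measurable_indicator_leb02\<close>)
    also have "\<dots> = 0"
      by (rule ivl) auto
    finally show ?thesis .
  qed
  have si: "set_integrable leb02 (A \<inter> {0..2}) g" if "A \<in> sets borel" for A
    unfolding set_integrable_def using sets_leb02[OF that] g by (rule integrable_mult_indicator)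
  have gen: "sets borel = sigma_sets UNIV (range (\<lambda>(a, b). {a<..<b::real}))"
    by (subst borel_eq_box) (simp add: split_def)
  have stable: "Int_stable (range (\<lambda>(a, b). {a<..<b::real}))"
  proof (rule Int_stableI)
    fix A B assume "A \<in> range (\<lambda>(a, b). {a<..<b::real})" "B \<in> range (\<lambda>(a, b). {a<..<b::real})"
    then obtain a b c d where "A = {a<..<b}" "B = {c<..<d}"
      by auto
    then have "A \<inter> B = (\<lambda>(a, b). {a<..<b}) (max a c, min b d)"
      by auto
    then show "A \<inter> B \<in> range (\<lambda>(a, b). {a<..<b::real})"
      by blast
  qed
  show ?thesis
    using stable subset_UNIV[of "range (\<lambda>(a, b). {a<..<b::real})", folded Pow_UNIV] A[unfolded gen]
  proof (induction rule: sigma_sets_induct_disjoint)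
    case (basic A)
    then show ?case
      using open_ivl by auto
  next
    case empty
    then show ?case by (simp add: set_lebesgue_integral_def)
  next
    case (compl A)
    have "(LINT x:(A \<inter> {0..2}) \<union> ((UNIV - A) \<inter> {0..2})|leb02. g x) =
        (LINT x:A \<inter> {0..2}|leb02. g x) + (LINT x:(UNIV - A) \<inter> {0..2}|leb02. g x)"
      using compl by (intro set_integral_Un si) (auto simp: gen intro: sigma_sets.Compl)
    \<comment> \<open>All of [0,2] is the trace of the single generator (-1,3), so the total
      integral vanishes and complements follow.\<close>
    moreover have "(A \<inter> {0..2}) \<union> ((UNIV - A) \<inter> {0..2}) = {-1<..<3} \<inter> {0..2}"
      by auto
    ultimately show ?case
      using compl open_ivl[of "-1" 3] by simp
  next
    case (union A)
    have m: "A i \<in> sets borel" for i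
      using union by (auto simp: gen)
    have "(LINT x:(\<Union>i. A i \<inter> {0..2})|leb02. g x) = (\<Sum>i. LINT x:A i \<inter> {0..2}|leb02. g x)"
    proof (rule lebesgue_integral_countable_add)
      show "set_integrable leb02 (\<Union>i. A i \<inter> {0..2}) g"
        using si[of "\<Union>i. A i"] m by (simp add: Int_UN_distrib2 Int_commute)
    qed (use union m sets_leb02 in \<open>auto simp: disjoint_family_on_def\<close>)
    then show ?case
      using union by (simp add: Int_UN_distrib2 Int_commute)
  qed
qed

lemma set_integral_zero_if_lebesgue:
  fixes g :: "real \<Rightarrow> complex"
  assumes g: "integrable leb02 g"
    and ivl: "\<And>a b. 0 \<le> a \<Longrightarrow> b \<le> 2 \<Longrightarrow> (LINT x|leb02. indicator {a<..<b} x *\<^sub>R g x) = 0"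
    and A: "A \<in> sets leb02"
  shows "(LINT x:A|leb02. g x) = 0"
proof -
  obtain B where B: "B \<in> sets lebesgue" "A = B \<inter> {0..2}"
    using A by (auto simp: sets_restrict_space)
  obtain S N N' where S: "B = S \<union> N" "N \<subseteq> N'" "N' \<in> null_sets lborel" "S \<in> sets lborel"
    using B(1) by (rule sets_completionE)
  have "AE x in lebesgue. x \<notin> N'"
    using AE_not_in[OF S(3)] by (rule AE_completion)
  then have N: "AE x in leb02. x \<notin> N'"
    by (subst AE_restrict_space_iff) auto
  have "(LINT x:A|leb02. g x) = (LINT x:S \<inter> {0..2}|leb02. g x)"
    unfolding set_lebesgue_integral_def
  proof (rule integral_cong_AE)
    show "AE x in leb02. indicat_real A x *\<^sub>R g x = indicat_real (S \<inter> {0..2}) x *\<^sub>R g x"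
      using N by eventually_elim (use B S in \<open>auto simp: indicator_def\<close>)
  qed (use g A S sets_leb02[of S] in auto)
  also have "\<dots> = 0"
    using S by (intro set_integral_zero_if_borel[OF g ivl]) auto
  finally show ?thesis .
qed

text \<open>Integrating over the set where Re (c g) > 0 shows that this set is null; the four
  directions c = 1, -1, i, -i together force g = 0.\<close>

lemma AE_zero_if_interval_integrals_zero:
  fixes g :: "real \<Rightarrow> complex"
  assumes g: "integrable leb02 g"
    and ivl: "\<And>a b. 0 \<le> a \<Longrightarrow> b \<le> 2 \<Longrightarrow> (LINT x|leb02. indicator {a<..<b} x *\<^sub>R g x) = 0"
  shows "AE x in leb02. g x = 0"
proof -
  have Re_le: "AE x in leb02. Re (c * g x) \<le> 0" for c
  proof -
    define A where "A = {x \<in> space leb02. Re (c * g x) > 0}"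
    have [measurable]: "g \<in> borel_measurable leb02"
      using g by auto
    have A: "A \<in> sets leb02"
      unfolding A_def by measurable
    have ci: "integrable leb02 (\<lambda>x. indicator A x *\<^sub>R (c * g x))"
      using A g by (intro integrable_mult_indicator) auto
    have "(LINT x:A|leb02. c * g x) = c * (LINT x:A|leb02. g x)"
      by (rule set_integral_mult_right)
    also have "\<dots> = 0"
      using set_integral_zero_if_lebesgue[OF g ivl A] by simp
    finally have "0 = Re (LINT x|leb02. indicator A x *\<^sub>R (c * g x))"
      unfolding set_lebesgue_integral_def by (metis zero_complex.sel(1))
    also have "\<dots> = (LINT x|leb02. indicator A x * Re (c * g x))"
      using integral_Re[OF ci] by simp
    finally have "AE x in leb02. indicator A x * Re (c * g x) = 0"
    proof (subst (asm) eq_commute, subst (asm) integral_nonneg_eq_0_iff_AE)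
      show "integrable leb02 (\<lambda>x. indicat_real A x * Re (c * g x))"
        using integrable_Re[OF ci] by simp
      show "AE x in leb02. 0 \<le> indicat_real A x * Re (c * g x)"
        by (auto simp: A_def indicator_def)
    qed
    then show ?thesis
      using AE_space by eventually_elim (auto simp: A_def indicator_def not_less split: if_splits)
  qed
  show ?thesis
    using Re_le[of 1] Re_le[of "-1"] Re_le[of \<i>] Re_le[of "-\<i>"]
    by eventually_elim (auto simp: complex_eq_iff)
qed

text \<open>The fundamental lemma: the bumps stay between 0 and 1 and converge to the indicator of
  an open interval, so dominated convergence passes from test functions to intervals.\<close>

lemma AE_zero_if_test_integrals_zero:
  fixes g :: "real \<Rightarrow> complex"
  assumes g: "integrable leb02 g"
    and test: "\<And>\<phi>. test_fun \<phi> \<Longrightarrow> (LINT x|leb02. g x * of_real (\<phi> x)) = 0"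
  shows "AE x in leb02. g x = 0"
proof (rule AE_zero_if_interval_integrals_zero[OF g])
  fix a b :: real assume ab: "0 \<le> a" "b \<le> 2"
  have [measurable]: "g \<in> borel_measurable leb02"
    using g by auto
  have meas: "bump n a b \<in> borel_measurable leb02" for n
    using test_fun_bump[OF ab, of n] unfolding test_fun_iff
    by (intro borel_measurable_leb02_continuous continuous_at_imp_continuous_on ballI)
       (auto intro: DERIV_isCont smooth_fun_DERIV)
  have "(\<lambda>n. LINT x|leb02. bump n a b x *\<^sub>R g x) \<longlonglongrightarrow> (LINT x|leb02. indicator {a<..<b} x *\<^sub>R g x)"
  proof (rule integral_dominated_convergence)
    show "integrable leb02 (\<lambda>x. norm (g x))"
      using g by simp
    show "AE x in leb02. (\<lambda>n. bump n a b x *\<^sub>R g x) \<longlonglongrightarrow> indicat_real {a<..<b} x *\<^sub>R g x"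
      by (intro AE_I2 tendsto_intros bump_tendsto)
    show "AE x in leb02. norm (bump n a b x *\<^sub>R g x) \<le> norm (g x)" for n
      using bump_bounds by (auto simp: mult_left_le_one_le)
  qed (use meas in \<open>auto intro!: borel_measurable_scaleR borel_measurable_indicator_leb02\<close>)
  moreover have "(LINT x|leb02. bump n a b x *\<^sub>R g x) = 0" for n
    using test[OF test_fun_bump[OF ab]] by (simp add: scaleR_conv_of_real mult.commute)
  ultimately show "(LINT x|leb02. indicator {a<..<b} x *\<^sub>R g x) = 0"
    by (simp add: LIMSEQ_const_iff)
qed

section \<open>Indefinite integrals of integrable functions\<close>

text \<open>Absolute continuity on [0,2] in integral form. The derivative g matters only up to null
  sets and needs no pointwise meaning. Integrability is Lebesgue, for Fubini and a.e. arguments,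
  while \<open>integral\<close> is the gauge integral, for which continuity of the primitive and a
  strong fundamental theorem are available.\<close>

definition is_prim :: "(real \<Rightarrow> complex) \<Rightarrow> (real \<Rightarrow> complex) \<Rightarrow> bool" where
  "is_prim G g \<longleftrightarrow> integrable leb02 g \<and> (\<forall>x\<in>{0..2}. G x = G 0 + integral {0..x} g)"

lemma is_primD:
  assumes "is_prim G g"
  shows "integrable leb02 g" "x \<in> {0..2} \<Longrightarrow> G x = G 0 + integral {0..x} g"
  using assms unfolding is_prim_def by blast+

lemma integrable_leb02_indicator:
  fixes g :: "real \<Rightarrow> complex"
  assumes "integrable leb02 g" "x \<in> {0..2}"
  shows "integrable leb02 (\<lambda>t. indicator {0..x} t *\<^sub>R g t)"
  using assms by (intro integrable_mult_indicator sets_leb02_atLeastAtMost) auto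

lemma integral_leb02_indicator:
  fixes g :: "real \<Rightarrow> complex"
  assumes "integrable leb02 g" "x \<in> {0..2}"
  shows "(LINT t|leb02. indicator {0..x} t *\<^sub>R g t) = integral {0..x} g"
proof -
  have "(LINT t|leb02. indicator {0..x} t *\<^sub>R g t) = integral {0..2} (\<lambda>t. indicator {0..x} t *\<^sub>R g t)"
    using integrable_leb02_indicator[OF assms] by (intro lebesgue_integral_eq_integral) auto
  also have "\<dots> = integral {0..2} (\<lambda>t. if t \<in> {0..x} then g t else 0)"
    by (intro Henstock_Kurzweil_Integration.integral_cong) (auto simp: indicator_def)
  also have "\<dots> = integral {0..x} g"
    using assms(2) by (subst Henstock_Kurzweil_Integration.integral_restrict_Int) (simp add: inf.absorb1)
  finally show ?thesis .
qed

lemma integral_leb02_whole: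
  fixes g :: "real \<Rightarrow> complex"
  assumes "integrable leb02 g"
  shows "(LINT t|leb02. g t) = integral {0..2} g"
  using assms by (intro lebesgue_integral_eq_integral) auto

lemma continuous_on_leb02_integral:
  fixes g :: "real \<Rightarrow> complex"
  assumes "integrable leb02 g"
  shows "continuous_on {0..2} (\<lambda>x. integral {0..x} g)"
  using assms by (intro indefinite_integral_continuous_1 integrable_on_lebesgue_on) auto

lemma is_prim_integral:
  "integrable leb02 g \<Longrightarrow> is_prim (\<lambda>x. integral {0..x} g) g"
  by (simp add: is_prim_def)

lemma is_prim_continuous:
  assumes "is_prim G g"
  shows "continuous_on {0..2} G"
proof (rule continuous_on_eq)
  show "continuous_on {0..2} (\<lambda>x. G 0 + integral {0..x} g)"
    using is_primD(1)[OF assms] by (intro continuous_intros continuous_on_leb02_integral)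
qed (simp add: is_primD(2)[OF assms, symmetric])

lemma is_prim_cong_AE:
  assumes "is_prim G g" "AE x in leb02. g x = g' x" "g' \<in> borel_measurable leb02"
    "\<And>x. x \<in> {0..2} \<Longrightarrow> G x = G' x"
  shows "is_prim G' g'"
proof -
  have g: "integrable leb02 g"
    using assms(1) by (rule is_primD)
  have g': "integrable leb02 g'"
    using g assms(2,3) by (subst integrable_cong_AE[of _ _ g]) auto
  have "integral {0..x} g = integral {0..x} g'" if x: "x \<in> {0..2}" for x
  proof -
    have "(LINT t|leb02. indicator {0..x} t *\<^sub>R g t) = (LINT t|leb02. indicator {0..x} t *\<^sub>R g' t)"
      using integrable_leb02_indicator[OF g x] integrable_leb02_indicator[OF g' x] assms(2)
      by (intro integral_cong_AE) auto
    then show ?thesis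
      using integral_leb02_indicator[OF g x] integral_leb02_indicator[OF g' x] by simp
  qed
  then have "G' x = G' 0 + integral {0..x} g'" if "x \<in> {0..2}" for x
    using that is_primD(2)[OF assms(1) that] assms(4)[of x] assms(4)[of 0] by simp
  then show ?thesis
    using g' unfolding is_prim_def by blast
qed

lemma is_prim_cong:
  assumes "is_prim G g" "\<And>x. x \<in> {0..2} \<Longrightarrow> g x = g' x" "\<And>x. x \<in> {0..2} \<Longrightarrow> G x = G' x"
  shows "is_prim G' g'"
proof (rule is_prim_cong_AE[OF assms(1)])
  show "AE x in leb02. g x = g' x"
    using assms(2) by (intro AE_I2) auto
  show "g' \<in> borel_measurable leb02"
    using is_primD(1)[OF assms(1)] assms(2) measurable_cong[of leb02 g g' borel] by auto
qed (rule assms(3))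

text \<open>The finite exceptional set \<open>S\<close> admits functions with a kink, such as
  solutions glued at the interface x = 1.\<close>

lemma is_prim_FTC:
  assumes "finite S" "continuous_on {0..2} G"
    "\<And>x. x \<in> {0<..<2} - S \<Longrightarrow> (G has_vector_derivative g x) (at x)" "integrable leb02 g"
  shows "is_prim G g"
proof -
  have "(g has_integral (G x - G 0)) {0..x}" if "x \<in> {0..2}" for x
    using that assms
    by (intro fundamental_theorem_of_calculus_interior_strong[OF assms(1)])
       (auto elim: continuous_on_subset)
  then have "integral {0..x} g = G x - G 0" if "x \<in> {0..2}" for x
    using that by (intro integral_unique)
  then show ?thesis
    using assms(4) unfolding is_prim_def by (auto simp: algebra_simps)
qed

lemma integrable_on_leb02:
  fixes g :: "real \<Rightarrow> complex"
  assumes "integrable leb02 g" "x \<in> {0..2}"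
  shows "g integrable_on {0..x}"
proof (rule integrable_on_subinterval)
  show "g integrable_on {0..2}"
    using assms(1) by (rule integrable_on_lebesgue_on) simp
qed (use assms(2) in auto)

lemma is_prim_add:
  assumes "is_prim G g" "is_prim H h"
  shows "is_prim (\<lambda>x. G x + H x) (\<lambda>x. g x + h x)"
proof -
  have "integral {0..x} (\<lambda>t. g t + h t) = integral {0..x} g + integral {0..x} h" if "x \<in> {0..2}" for x
    using assms[THEN is_primD(1)] that
    by (intro Henstock_Kurzweil_Integration.integral_add integrable_on_leb02)
  moreover have "G x + H x = G 0 + H 0 + (integral {0..x} g + integral {0..x} h)" if "x \<in> {0..2}" for x
    using is_primD(2)[OF assms(1) that] is_primD(2)[OF assms(2) that] by simp
  ultimately have "G x + H x = G 0 + H 0 + integral {0..x} (\<lambda>t. g t + h t)" if "x \<in> {0..2}" for x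
    using that by (simp only:)
  then show ?thesis
    using Bochner_Integration.integrable_add[OF assms[THEN is_primD(1)]] unfolding is_prim_def by blast
qed

lemma is_prim_cmult:
  assumes "is_prim G g"
  shows "is_prim (\<lambda>x. c * G x) (\<lambda>x. c * g x)"
  unfolding is_prim_def
proof (intro conjI ballI)
  fix x :: real assume x: "x \<in> {0..2}"
  show "c * G x = c * G 0 + integral {0..x} (\<lambda>x. c * g x)"
    by (subst is_primD(2)[OF assms x]) (simp add: ring_distribs)
qed (use is_primD(1)[OF assms] in simp)

lemma is_prim_diff:
  assumes "is_prim G g" "is_prim H h"
  shows "is_prim (\<lambda>x. G x - H x) (\<lambda>x. g x - h x)"
  using is_prim_add[OF assms(1) is_prim_cmult[OF assms(2), of "-1"]] by simp

lemma is_prim_const: "is_prim (\<lambda>_. c) (\<lambda>_. 0)"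
  by (simp add: is_prim_def)

lemma is_prim_cnj:
  assumes "is_prim G g"
  shows "is_prim (\<lambda>x. cnj (G x)) (\<lambda>x. cnj (g x))"
  unfolding is_prim_def
proof (intro conjI ballI)
  fix x :: real assume x: "x \<in> {0..2}"
  show "cnj (G x) = cnj (G 0) + integral {0..x} (\<lambda>x. cnj (g x))"
    by (subst is_primD(2)[OF assms x]) (simp add: Henstock_Kurzweil_Integration.integral_cnj)
qed (use is_primD(1)[OF assms] in simp)

text \<open>The square [0,2] x [0,2] is cut along the diagonal. The triangle t \<le> s, integrated
  over t first, gives the first summand; integrated over s first, it gives the full product minus
  the second.\<close>

lemma fubini_triangle:
  fixes g h :: "real \<Rightarrow> complex"
  assumes g: "integrable leb02 g" and h: "integrable leb02 h"
  shows "(LINT s|leb02. g s * integral {0..s} h) + (LINT t|leb02. h t * integral {0..t} g) =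
    (LINT s|leb02. g s) * (LINT t|leb02. h t)"
proof -
  interpret finite_measure leb02 by (rule finite_measure_leb02)
  interpret pair_sigma_finite leb02 leb02 ..
  let ?P = "leb02 \<Otimes>\<^sub>M leb02"
  have [measurable]: "g \<in> borel_measurable leb02" "h \<in> borel_measurable leb02"
    using g h by auto
  have prod: "integrable ?P (\<lambda>p. g (fst p) * h (snd p))"
  proof (rule Fubini_integrable)
    show "integrable leb02 (\<lambda>x. LINT y|leb02. norm (g (fst (x, y)) * h (snd (x, y))))"
      using g by (simp add: norm_mult)
    show "AE x in leb02. integrable leb02 (\<lambda>y. g (fst (x, y)) * h (snd (x, y)))"
      using h by simp
  qed measurable
  define T where "T = {p \<in> space ?P. snd p \<le> fst p}"
  have id: "(\<lambda>x. x) \<in> borel_measurable leb02"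
    using id_borel_measurable_lebesgue_on[of "{0..2}"] by (simp add: id_def)
  have [measurable]: "fst \<in> borel_measurable ?P" "snd \<in> borel_measurable ?P"
    using measurable_compose[OF measurable_fst id] measurable_compose[OF measurable_snd id] by auto
  have T: "T \<in> sets ?P"
    unfolding T_def by measurable
  have Tint: "integrable ?P (\<lambda>(s, t). indicator T (s, t) *\<^sub>R (g s * h t))"
    using integrable_mult_indicator[OF T prod] by (simp add: split_def)
  have inner1: "(LINT t|leb02. indicator T (s, t) *\<^sub>R (g s * h t)) = g s * integral {0..s} h"
    if s: "s \<in> {0..2}" for s
  proof -
    have "(LINT t|leb02. indicator T (s, t) *\<^sub>R (g s * h t)) =
        (LINT t|leb02. g s * (indicator {0..s} t *\<^sub>R h t))"
      using s by (intro Bochner_Integration.integral_cong)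
        (auto simp: T_def space_pair_measure indicator_def)
    also have "\<dots> = g s * (LINT t|leb02. indicator {0..s} t *\<^sub>R h t)"
      by (rule integral_mult_right_zero)
    finally show ?thesis
      using integral_leb02_indicator[OF h s] by simp
  qed
  have inner2: "(LINT s|leb02. indicator T (s, t) *\<^sub>R (g s * h t)) =
      h t * ((LINT s|leb02. g s) - integral {0..t} g)" if t: "t \<in> {0..2}" for t
  proof -
    \<comment> \<open>The diagonal belongs to both closed triangles; for fixed t it contributes only
      the null set s = t.\<close>
    have "AE s in lebesgue. s \<noteq> t"
      using AE_completion[OF AE_lborel_singleton] .
    then have ne: "AE s in leb02. s \<noteq> t"
      by (subst AE_restrict_space_iff) auto
    have "(LINT s|leb02. indicator T (s, t) *\<^sub>R (g s * h t)) =
        (LINT s|leb02. h t * (g s - indicator {0..t} s *\<^sub>R g s))"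
    proof (rule integral_cong_AE)
      show "AE s in leb02. indicat_real T (s, t) *\<^sub>R (g s * h t) = h t * (g s - indicat_real {0..t} s *\<^sub>R g s)"
        using ne AE_space
        by eventually_elim (use t in \<open>auto simp: T_def space_pair_measure indicator_def\<close>)
      show "(\<lambda>s. indicat_real T (s, t) *\<^sub>R (g s * h t)) \<in> borel_measurable leb02"
        using T t by (intro borel_measurable_scaleR measurable_compose[OF measurable_Pair2' borel_measurable_indicator]) auto
      show "(\<lambda>s. h t * (g s - indicat_real {0..t} s *\<^sub>R g s)) \<in> borel_measurable leb02"
        using integrable_leb02_indicator[OF g t] by measurable
    qed
    also have "\<dots> = h t * ((LINT s|leb02. g s) - (LINT s|leb02. indicator {0..t} s *\<^sub>R g s))"
      using g integrable_leb02_indicator[OF g t] by simp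
    finally show ?thesis
      using integral_leb02_indicator[OF g t] by simp
  qed
  have hI: "integrable leb02 (\<lambda>t. h t * integral {0..t} g)"
    using integrable_leb02_mult_continuous[OF h continuous_on_leb02_integral[OF g]]
    by (simp add: mult.commute)
  have "(LINT s|leb02. g s * integral {0..s} h) =
      (LINT s|leb02. LINT t|leb02. indicator T (s, t) *\<^sub>R (g s * h t))"
    using inner1 by (intro Bochner_Integration.integral_cong) auto
  also have "\<dots> = (LINT t|leb02. LINT s|leb02. indicator T (s, t) *\<^sub>R (g s * h t))"
    by (rule Fubini_integral[symmetric, OF Tint])
  also have "\<dots> = (LINT t|leb02. h t * (LINT s|leb02. g s) - h t * integral {0..t} g)"
    using inner2 by (intro Bochner_Integration.integral_cong) (auto simp: right_diff_distrib)
  also have "\<dots> = (LINT s|leb02. g s) * (LINT t|leb02. h t) - (LINT t|leb02. h t * integral {0..t} g)"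
    using h hI by simp
  finally show ?thesis
    by simp
qed

text \<open>The product rule without pointwise derivatives. Cutting g and h off beyond x turns an
  identity on [0,x] into one on all of [0,2], where \<open>fubini_triangle\<close> yields (G x - G
  0) (H x - H 0); the remaining terms carry the initial values.\<close>

lemma is_prim_mult:
  assumes G: "is_prim G g" and H: "is_prim H h"
  shows "is_prim (\<lambda>x. G x * H x) (\<lambda>x. g x * H x + G x * h x)"
proof -
  note g = is_primD(1)[OF G] and h = is_primD(1)[OF H]
  have int: "integrable leb02 (\<lambda>x. H x * g x)" "integrable leb02 (\<lambda>x. G x * h x)"
    using integrable_leb02_mult_continuous is_prim_continuous G H g h by blast+
  have sum_int: "integrable leb02 (\<lambda>x. g x * H x + G x * h x)"
    using int by (simp add: mult.commute)
  have "integral {0..x} (\<lambda>x. g x * H x + G x * h x) = G x * H x - G 0 * H 0" if x: "x \<in> {0..2}" for x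
  proof -
    define g' where "g' = (\<lambda>t. indicator {0..x} t *\<^sub>R g t)"
    define h' where "h' = (\<lambda>t. indicator {0..x} t *\<^sub>R h t)"
    have g': "integrable leb02 g'" and h': "integrable leb02 h'"
      unfolding g'_def h'_def using g h x by (auto intro: integrable_leb02_indicator)
    have G': "g' s * integral {0..s} h' = indicator {0..x} s *\<^sub>R (g s * H s) - H 0 * (indicator {0..x} s *\<^sub>R g s)"
      and H': "h' s * integral {0..s} g' = indicator {0..x} s *\<^sub>R (h s * G s) - G 0 * (indicator {0..x} s *\<^sub>R h s)"
      if s: "s \<in> {0..2}" for s
    proof -
      have ind: "indicat_real {0..x} s = (if s \<le> x then 1 else 0)"
        using s by auto
      have gh': "g' s = (if s \<le> x then g s else 0)" "h' s = (if s \<le> x then h s else 0)"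
        unfolding g'_def h'_def ind by auto
      have I: "integral {0..s} h' = H s - H 0" "integral {0..s} g' = G s - G 0" if "s \<le> x"
      proof -
        have "integral {0..s} h' = integral {0..s} h" "integral {0..s} g' = integral {0..s} g"
          using that by (auto intro!: Henstock_Kurzweil_Integration.integral_cong simp: h'_def g'_def)
        then show "integral {0..s} h' = H s - H 0" "integral {0..s} g' = G s - G 0"
          by (simp_all only: is_primD(2)[OF G s] is_primD(2)[OF H s] add_diff_cancel_left')
      qed
      show "g' s * integral {0..s} h' = indicator {0..x} s *\<^sub>R (g s * H s) - H 0 * (indicator {0..x} s *\<^sub>R g s)"
        "h' s * integral {0..s} g' = indicator {0..x} s *\<^sub>R (h s * G s) - G 0 * (indicator {0..x} s *\<^sub>R h s)"
        unfolding ind gh' by (cases "s \<le> x"; simp add: I right_diff_distrib mult.commute)+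
    qed
    have Ig: "(LINT s|leb02. g' s) = G x - G 0" and Ih: "(LINT s|leb02. h' s) = H x - H 0"
      using integral_leb02_indicator[OF g x] integral_leb02_indicator[OF h x]
        is_primD(2)[OF G x] is_primD(2)[OF H x] by (auto simp: g'_def h'_def)
    have 1: "(LINT s|leb02. g' s * integral {0..s} h') =
        (LINT s|leb02. indicator {0..x} s *\<^sub>R (g s * H s) - H 0 * g' s)"
      using G' by (intro Bochner_Integration.integral_cong) (auto simp: g'_def)
    have 2: "(LINT s|leb02. h' s * integral {0..s} g') =
        (LINT s|leb02. indicator {0..x} s *\<^sub>R (h s * G s) - G 0 * h' s)"
      using H' by (intro Bochner_Integration.integral_cong) (auto simp: h'_def)
    have int': "integrable leb02 (\<lambda>s. indicator {0..x} s *\<^sub>R (g s * H s))"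
       "integrable leb02 (\<lambda>s. indicator {0..x} s *\<^sub>R (h s * G s))"
      using int x by (auto intro!: integrable_leb02_indicator simp: mult.commute)
    have "integral {0..x} (\<lambda>x. g x * H x + G x * h x) =
        (LINT s|leb02. indicator {0..x} s *\<^sub>R (g s * H s)) + (LINT s|leb02. indicator {0..x} s *\<^sub>R (h s * G s))"
      using int' by (subst integral_leb02_indicator[OF sum_int x, symmetric])
        (simp add: scaleR_add_right mult.commute)
    also have "\<dots> = (LINT s|leb02. g' s * integral {0..s} h') + H 0 * (G x - G 0)
        + (LINT s|leb02. h' s * integral {0..s} g') + G 0 * (H x - H 0)"
      unfolding 1 2 using int' g' h' Ig Ih by simp
    also have "\<dots> = G x * H x - G 0 * H 0"
      using fubini_triangle[OF g' h'] Ig Ih by (simp add: algebra_simps)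
    finally show ?thesis .
  qed
  then have "G x * H x = G 0 * H 0 + integral {0..x} (\<lambda>x. g x * H x + G x * h x)"
    if "x \<in> {0..2}" for x
    using that by simp
  then show ?thesis
    using sum_int unfolding is_prim_def by blast
qed

lemma integration_by_parts_prim:
  assumes G: "is_prim G g" and H: "is_prim H h"
  shows "(LINT x|leb02. g x * H x) = G 2 * H 2 - G 0 * H 0 - (LINT x|leb02. G x * h x)"
proof -
  have int: "integrable leb02 (\<lambda>x. H x * g x)" "integrable leb02 (\<lambda>x. G x * h x)"
    using integrable_leb02_mult_continuous is_prim_continuous G H is_primD(1) by blast+
  have "(LINT x|leb02. g x * H x + G x * h x) = G 2 * H 2 - G 0 * H 0"
    using is_primD(1)[OF is_prim_mult[OF G H]] is_primD(2)[OF is_prim_mult[OF G H], of 2]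
    by (simp add: integral_leb02_whole)
  then show ?thesis
    using int by (simp add: mult.commute eq_diff_eq)
qed

section \<open>Weak derivatives\<close>

lemma test_fun_support:
  assumes "test_fun \<phi>"
  obtains a b where "0 < a" "a \<le> b" "b < 2" "\<And>x. \<phi> x \<noteq> 0 \<Longrightarrow> a \<le> x \<and> x \<le> b"
proof (cases "{x. \<phi> x \<noteq> 0} = {}")
  case True
  then show ?thesis
    by (intro that[of 1 1]) auto
next
  case False
  let ?K = "closure {x. \<phi> x \<noteq> 0}"
  have sub: "?K \<subseteq> {0<..<2}"
    using assms by (simp add: test_fun_def)
  then have "bounded ?K"
    by (intro bounded_subset[OF bounded_closed_interval, of _ 0 2]) auto
  then have K: "compact ?K"
    by (simp add: compact_eq_bounded_closed)
  have ne: "?K \<noteq> {}"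
    using False by simp
  obtain a where a: "a \<in> ?K" "\<And>x. x \<in> ?K \<Longrightarrow> a \<le> x"
    using compact_attains_inf[OF K ne] by blast
  obtain b where b: "b \<in> ?K" "\<And>x. x \<in> ?K \<Longrightarrow> x \<le> b"
    using compact_attains_sup[OF K ne] by blast
  show ?thesis
  proof (rule that)
    show "a \<le> x \<and> x \<le> b" if "\<phi> x \<noteq> 0" for x
      using a(2) b(2) that closure_subset[of "{x. \<phi> x \<noteq> 0}"] by blast
  qed (use a b sub in auto)
qed

lemma test_funI:
  assumes "smooth_fun \<phi>" "0 < a" "b < 2" "\<And>x. \<phi> x \<noteq> 0 \<Longrightarrow> a \<le> x \<and> x \<le> b"
  shows "test_fun \<phi>"
proof -
  have "closure {x. \<phi> x \<noteq> 0} \<subseteq> {a..b}"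
    using assms(4) by (intro closure_minimal) auto
  then show ?thesis
    using assms by (auto simp: test_fun_iff)
qed

lemma smooth_fun_continuous_on: "smooth_fun f \<Longrightarrow> continuous_on S f"
  by (intro continuous_at_imp_continuous_on ballI DERIV_isCont[OF smooth_fun_DERIV])

text \<open>The primitive from the left vanishes before the support of \<eta>; mean zero is exactly
  what makes it vanish again after the support.\<close>

lemma test_fun_antideriv:
  assumes \<eta>: "test_fun \<eta>" and int0: "(LINT x|leb02. \<eta> x) = 0"
  obtains \<Phi> where "test_fun \<Phi>" "deriv \<Phi> = \<eta>"
proof -
  obtain a b where ab: "0 < a" "a \<le> b" "b < 2" and supp: "\<And>x. \<eta> x \<noteq> 0 \<Longrightarrow> a \<le> x \<and> x \<le> b"
    using test_fun_support[OF \<eta>] by metis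
  have smooth: "smooth_fun \<eta>"
    using \<eta> by (simp add: test_fun_iff)
  note cont = smooth_fun_continuous_on[OF smooth]
  define \<Phi> where "\<Phi> x = integral {-1..x} \<eta>" for x
  have left: "\<Phi> x = 0" if "x < a" for x
  proof -
    have "\<Phi> x = integral {-1..x} (\<lambda>_. 0)"
      unfolding \<Phi>_def
      using that supp by (intro Henstock_Kurzweil_Integration.integral_cong) force
    then show ?thesis by simp
  qed
  have deriv: "(\<Phi> has_real_derivative \<eta> x) (at x)" for x
  proof (cases "x < a")
    case True
    have "\<forall>\<^sub>F y in nhds x. \<Phi> y = 0"
      using True left by (intro eventually_nhds_in_open[of "{..<a}", THEN eventually_mono]) auto
    moreover have "\<eta> x = 0"
      using True supp by force
    ultimately show ?thesis
      by (subst DERIV_cong_ev[OF refl _ refl]) auto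
  next
    case False
    have "(\<Phi> has_real_derivative \<eta> x) (at x within {-1..x + 1})"
      unfolding \<Phi>_def using False ab by (intro integral_has_real_derivative cont) auto
    moreover have "at x within {-1..x + 1} = at x"
      using False ab by (intro at_within_interior) auto
    ultimately show ?thesis
      by simp
  qed
  have right: "\<Phi> x = 0" if "b < x" for x
  proof -
    have int: "\<eta> integrable_on {c..d}" for c d
      by (intro integrable_continuous_real cont)
    have zero: "integral {c..d} \<eta> = 0" if "d \<le> 0 \<or> b < c" for c d
    proof -
      have "integral {c..d} \<eta> = integral {c..d} (\<lambda>_. 0)"
        using that \<open>b < x\<close> ab supp by (intro Henstock_Kurzweil_Integration.integral_cong) force
      then show ?thesis by simp
    qed
    have "integral {0..2} \<eta> = 0"
      using int0 lebesgue_integral_eq_integral[of "{0..2}" \<eta>] continuous_imp_integrable_real[OF cont]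
      by simp
    \<comment> \<open>A point x > b may lie on either side of 2, so both decompositions are taken up
      to \<open>max x 2\<close>.\<close>
    moreover have "integral {-1..0} \<eta> + integral {0..max x 2} \<eta> = integral {-1..max x 2} \<eta>"
      by (intro Henstock_Kurzweil_Integration.integral_combine int) auto
    moreover have "integral {0..2} \<eta> + integral {2..max x 2} \<eta> = integral {0..max x 2} \<eta>"
      by (intro Henstock_Kurzweil_Integration.integral_combine int) auto
    moreover have "integral {-1..x} \<eta> + integral {x..max x 2} \<eta> = integral {-1..max x 2} \<eta>"
      using that ab by (intro Henstock_Kurzweil_Integration.integral_combine int) auto
    moreover have "integral {2..max x 2} \<eta> = 0"
      using ab by (intro zero) auto
    ultimately show ?thesis
      using zero[of 0 "-1"] zero[of "max x 2" x] \<open>b < x\<close> by (simp add: \<Phi>_def)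
  qed
  show ?thesis
  proof (rule that)
    show "test_fun \<Phi>"
      using left right by (intro test_funI[OF smooth_fun_antideriv[OF deriv smooth] ab(1,3)]) force
    show "deriv \<Phi> = \<eta>"
      using deriv by (auto intro: DERIV_imp_deriv)
  qed
qed

lemma is_prim_of_real:
  assumes "smooth_fun \<phi>"
  shows "is_prim (\<lambda>x. of_real (\<phi> x)) (\<lambda>x. of_real (deriv \<phi> x))"
proof (rule is_prim_FTC)
  show "continuous_on {0..2} (\<lambda>x. complex_of_real (\<phi> x))"
    by (intro continuous_intros smooth_fun_continuous_on assms)
  show "integrable leb02 (\<lambda>x. complex_of_real (deriv \<phi> x))"
    by (intro integrable_leb02_continuous continuous_intros smooth_fun_continuous_on smooth_fun_deriv assms)
  show "((\<lambda>x. complex_of_real (\<phi> x)) has_vector_derivative of_real (deriv \<phi> x)) (at x)" for x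
    using smooth_fun_DERIV[OF assms, of x]
    by (simp add: has_vector_derivative_of_real has_real_derivative_iff_has_vector_derivative)
qed auto

lemma test_fun_ends: "test_fun \<phi> \<Longrightarrow> \<phi> 0 = 0 \<and> \<phi> 2 = 0"
  by (elim test_fun_support) force

text \<open>Otherwise the fundamental lemma, applied to the constant 1, would give 1 = 0 a.e.; no
  integral of a bump has to be computed.\<close>

lemma test_fun_nonzero_integral:
  obtains \<theta> where "test_fun \<theta>" "(LINT x|leb02. \<theta> x) \<noteq> 0"
proof (rule ccontr)
  assume contr: "\<not> thesis"
  have "AE x in leb02. (1::complex) = 0"
  proof (rule AE_zero_if_test_integrals_zero)
    fix \<phi> assume "test_fun \<phi>"
    then have "(LINT x|leb02. \<phi> x) = 0"
      using contr that by blast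
    then show "(LINT x|leb02. (1::complex) * of_real (\<phi> x)) = 0"
      by simp
  qed simp
  then have "(LINT x|leb02. (1::complex)) = (LINT x|leb02. 0)"
    by (intro integral_cong_AE) auto
  then show False
    using integral_leb02_whole[of "\<lambda>_. 1"] by simp
qed

text \<open>The lemma of du Bois-Reymond. Every test function is a multiple of a fixed \<theta> plus
  one of mean zero, and the latter is a derivative of a test function, which h annihilates. Hence h
  acts on test functions like the constant \<open>c\<close>, its average against \<theta>.\<close>

lemma AE_const_if_weak_deriv_zero:
  fixes h :: "real \<Rightarrow> complex"
  assumes h: "integrable leb02 h"
    and test: "\<And>\<phi>. test_fun \<phi> \<Longrightarrow> (LINT x|leb02. h x * of_real (deriv \<phi> x)) = 0"
  obtains c where "AE x in leb02. h x = c"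
proof -
  obtain \<theta> where \<theta>: "test_fun \<theta>" "(LINT x|leb02. \<theta> x) \<noteq> 0"
    by (rule test_fun_nonzero_integral)
  define I where "I = (LINT x|leb02. \<theta> x)"
  define c where "c = (LINT x|leb02. h x * of_real (\<theta> x)) / of_real I"
  have int: "integrable leb02 \<phi>" and hint: "integrable leb02 (\<lambda>x. h x * of_real (\<phi> x))"
    if "test_fun \<phi>" for \<phi>
  proof -
    have cont: "continuous_on {0..2} \<phi>"
      using that by (auto simp: test_fun_iff intro: smooth_fun_continuous_on)
    show "integrable leb02 \<phi>"
      using cont by (intro continuous_imp_integrable_real)
    have "continuous_on {0..2} (\<lambda>x. complex_of_real (\<phi> x))"
      using cont by (intro continuous_intros)
    from integrable_leb02_mult_continuous[OF h this]
    show "integrable leb02 (\<lambda>x. h x * of_real (\<phi> x))"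
      by (simp add: mult.commute)
  qed
  have "AE x in leb02. h x - c = 0"
  proof (rule AE_zero_if_test_integrals_zero)
    show "integrable leb02 (\<lambda>x. h x - c)"
      using h by simp
    fix \<phi> assume \<phi>: "test_fun \<phi>"
    define J where "J = (LINT x|leb02. \<phi> x)"
    obtain a b where ab: "0 < a" "a \<le> b" "b < 2" and a: "\<And>x. \<phi> x \<noteq> 0 \<Longrightarrow> a \<le> x \<and> x \<le> b"
      using test_fun_support[OF \<phi>] by metis
    obtain a' b' where ab': "0 < a'" "a' \<le> b'" "b' < 2" and a': "\<And>x. \<theta> x \<noteq> 0 \<Longrightarrow> a' \<le> x \<and> x \<le> b'"
      using test_fun_support[OF \<theta>(1)] by metis
    \<comment> \<open>The multiple of \<theta> is chosen to make the mean of \<eta> zero.\<close>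
    define \<eta> where "\<eta> x = \<phi> x + (- J / I) * \<theta> x" for x
    have "test_fun \<eta>"
    proof (rule test_funI)
      show "smooth_fun \<eta>"
        unfolding \<eta>_def using \<phi> \<theta> by (intro smooth_fun_add smooth_fun_mult smooth_fun_const) (auto simp: test_fun_iff)
      show "min a a' \<le> x \<and> x \<le> max b b'" if "\<eta> x \<noteq> 0" for x
        using that a[of x] a'[of x] by (cases "\<phi> x = 0") (auto simp: \<eta>_def)
    qed (use ab ab' in auto)
    moreover have "(LINT x|leb02. \<eta> x) = 0"
      using int[OF \<phi>] int[OF \<theta>(1)] \<theta>(2) by (simp add: \<eta>_def I_def J_def)
    ultimately obtain \<Phi> where \<Phi>: "test_fun \<Phi>" "deriv \<Phi> = \<eta>"
      by (rule test_fun_antideriv)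
    have "(LINT x|leb02. h x * of_real (\<phi> x) + of_real (- J / I) * (h x * of_real (\<theta> x))) =
        (LINT x|leb02. h x * of_real (deriv \<Phi> x))"
      unfolding \<Phi>(2) \<eta>_def by (intro Bochner_Integration.integral_cong) (auto simp: algebra_simps)
    also have "\<dots> = 0"
      by (rule test[OF \<Phi>(1)])
    finally have "(LINT x|leb02. h x * of_real (\<phi> x)) = c * of_real J"
      using hint[OF \<phi>] hint[OF \<theta>(1)] by (simp add: c_def)
    moreover have "(LINT x|leb02. c * complex_of_real (\<phi> x)) = c * of_real J"
      by (simp add: J_def)
    ultimately show "(LINT x|leb02. (h x - c) * of_real (\<phi> x)) = 0"
      using hint[OF \<phi>] int[OF \<phi>] by (auto simp: left_diff_distrib)
  qed
  then show ?thesis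
    by (intro that[of c]) auto
qed

lemma is_prim_test:
  assumes G: "is_prim G g" and \<phi>: "test_fun \<phi>"
  shows "(LINT x|leb02. G x * of_real (deriv \<phi> x)) = - (LINT x|leb02. g x * of_real (\<phi> x))"
  using integration_by_parts_prim[OF G is_prim_of_real, of \<phi>] \<phi> test_fun_ends[OF \<phi>]
  by (simp add: test_fun_iff)

section \<open>Classes in \<open>L2\<close> and their continuous representatives\<close>

lemma rep_L2: "square_int (rep_L2 u)"
  using Quotient_rep_reflp[OF Quotient_L2, of u] by simp

lemma abs_rep_L2: "abs_L2 (rep_L2 u) = u"
  by (rule Quotient_abs_rep[OF Quotient_L2])

lemma rep_abs_L2: "square_int f \<Longrightarrow> AE x in leb02. rep_L2 (abs_L2 f) x = f x"
  using Quotient_rep_abs[OF Quotient_L2, of f] by simp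

lemma abs_L2_eq_iff:
  "square_int f \<Longrightarrow> square_int g \<Longrightarrow> abs_L2 f = abs_L2 g \<longleftrightarrow> (AE x in leb02. f x = g x)"
  using Quotient_rel[OF Quotient_L2, of f g] by simp

lemma square_int_continuous:
  assumes "continuous_on {0..2} f"
  shows "square_int f"
proof -
  have "continuous_on {0..2} (\<lambda>x. (cmod (f x))\<^sup>2)"
    using assms by (intro continuous_intros)
  then show ?thesis
    using assms borel_measurable_leb02_continuous continuous_imp_integrable_real
    by (auto simp: square_int_def)
qed

lemma square_int_mult_continuous:
  assumes "square_int g" "continuous_on {0..2} m"
  shows "square_int (\<lambda>x. m x * g x)"
proof -
  have cont: "continuous_on {0..2} (\<lambda>x. complex_of_real ((cmod (m x))\<^sup>2))"
    using assms(2) by (intro continuous_intros)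
  have "integrable leb02 (\<lambda>x. complex_of_real ((cmod (g x))\<^sup>2))"
    using assms(1) by (subst complex_of_real_integrable_eq) (simp add: square_int_def)
  from integrable_leb02_mult_continuous[OF this cont]
  have "integrable leb02 (\<lambda>x. complex_of_real ((cmod (m x * g x))\<^sup>2))"
    by (simp add: norm_mult power_mult_distrib)
  then have "integrable leb02 (\<lambda>x. (cmod (m x * g x))\<^sup>2)"
    by (subst (asm) complex_of_real_integrable_eq)
  then show ?thesis
    using assms borel_measurable_leb02_continuous by (auto simp: square_int_def intro!: borel_measurable_times)
qed

lemma square_int_cnj:
  assumes "square_int f"
  shows "square_int (\<lambda>x. cnj (f x))"
proof -
  have "(\<lambda>x. cnj (f x)) \<in> borel_measurable leb02"
    using assms by (intro borel_measurable_continuous_on[where f = cnj])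
      (auto simp: square_int_def intro: continuous_intros)
  then show ?thesis
    using assms by (simp add: square_int_def)
qed

text \<open>\<open>U\<close> is the continuous representative of the class \<open>u\<close>, and \<open>g\<close> a weak derivative.\<close>

definition h1_rep :: "L2 \<Rightarrow> (real \<Rightarrow> complex) \<Rightarrow> (real \<Rightarrow> complex) \<Rightarrow> bool" where
  "h1_rep u U g \<longleftrightarrow> is_prim U g \<and> square_int g \<and> u = abs_L2 U"

lemma has_weak_deriv_h1_rep:
  assumes "h1_rep u U g"
  shows "has_weak_deriv u (abs_L2 g)"
  unfolding has_weak_deriv_def
proof (intro allI impI)
  fix \<phi> assume \<phi>: "test_fun \<phi>"
  have U: "is_prim U g" and g: "square_int g" and u: "u = abs_L2 U"
    using assms by (auto simp: h1_rep_def)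
  have sU: "square_int U"
    using U by (intro square_int_continuous is_prim_continuous)
  have cont: "continuous_on {0..2} (\<lambda>x. complex_of_real (\<phi> x))"
    "continuous_on {0..2} (\<lambda>x. complex_of_real (deriv \<phi> x))"
    using \<phi> by (auto simp: test_fun_iff intro!: continuous_intros smooth_fun_continuous_on smooth_fun_deriv)
  have [measurable]: "(\<lambda>x. complex_of_real (\<phi> x)) \<in> borel_measurable leb02"
    "(\<lambda>x. complex_of_real (deriv \<phi> x)) \<in> borel_measurable leb02"
    using cont by (auto intro: borel_measurable_leb02_continuous)
  have [measurable]: "U \<in> borel_measurable leb02" "g \<in> borel_measurable leb02" "rep_L2 v \<in> borel_measurable leb02" for v
    using sU g rep_L2 by (auto simp: square_int_def)
  have "(LINT x|leb02. rep_L2 u x * of_real (deriv \<phi> x)) = (LINT x|leb02. U x * of_real (deriv \<phi> x))"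
    unfolding u using rep_abs_L2[OF sU] by (intro integral_cong_AE) auto
  also have "\<dots> = - (LINT x|leb02. g x * of_real (\<phi> x))"
    by (rule is_prim_test[OF U \<phi>])
  also have "(LINT x|leb02. g x * of_real (\<phi> x)) = (LINT x|leb02. rep_L2 (abs_L2 g) x * of_real (\<phi> x))"
    using rep_abs_L2[OF g] by (intro integral_cong_AE) auto
  finally show "(LINT x|leb02. rep_L2 u x * of_real (deriv \<phi> x)) =
      - (LINT x|leb02. rep_L2 (abs_L2 g) x * of_real (\<phi> x))" .
qed

lemma integrable_rep_L2_test:
  assumes "smooth_fun \<phi>"
  shows "integrable leb02 (\<lambda>x. rep_L2 u x * of_real (\<phi> x))"
proof -
  have "continuous_on {0..2} (\<lambda>x. complex_of_real (\<phi> x))"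
    using assms by (intro continuous_intros smooth_fun_continuous_on)
  from integrable_leb02_mult_continuous[OF square_int_imp_integrable[OF rep_L2] this]
  show ?thesis
    by (simp add: mult.commute)
qed

lemma has_weak_deriv_unique:
  assumes "has_weak_deriv u g" "has_weak_deriv u h"
  shows "g = h"
proof -
  have "AE x in leb02. rep_L2 g x - rep_L2 h x = 0"
  proof (rule AE_zero_if_test_integrals_zero)
    show "integrable leb02 (\<lambda>x. rep_L2 g x - rep_L2 h x)"
      using rep_L2 square_int_imp_integrable by (intro Bochner_Integration.integrable_diff) auto
    fix \<phi> assume \<phi>: "test_fun \<phi>"
    then have "(LINT x|leb02. rep_L2 g x * of_real (\<phi> x)) = (LINT x|leb02. rep_L2 h x * of_real (\<phi> x))"
      using assms by (simp add: has_weak_deriv_def)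
    then show "(LINT x|leb02. (rep_L2 g x - rep_L2 h x) * of_real (\<phi> x)) = 0"
      using \<phi> by (simp add: left_diff_distrib integrable_rep_L2_test test_fun_iff)
  qed
  then have "abs_L2 (rep_L2 g) = abs_L2 (rep_L2 h)"
    by (subst abs_L2_eq_iff) (auto simp: rep_L2)
  then show ?thesis
    by (simp add: abs_rep_L2)
qed

lemma weak_deriv_h1_rep:
  assumes "h1_rep u U g"
  shows "weak_deriv u = abs_L2 g"
  unfolding weak_deriv_def
  using has_weak_deriv_h1_rep[OF assms] has_weak_deriv_unique by blast

lemma continuous_AE_eq:
  fixes f g :: "real \<Rightarrow> complex"
  assumes "continuous_on {0..2} f" "continuous_on {0..2} g" "AE x in leb02. f x = g x" "x \<in> {0..2}"
  shows "f x = g x"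
proof -
  have cont: "continuous_on {0..2} (\<lambda>x. cmod (f x - g x))"
    using assms(1,2) by (intro continuous_intros)
  have "(LINT x|leb02. cmod (f x - g x)) = (LINT x|leb02. 0)"
    using assms(3) cont by (intro integral_cong_AE) (auto intro: borel_measurable_leb02_continuous)
  then have "\<forall>x\<in>{0..2}. cmod (f x - g x) = 0"
    using integralL_eq_0_iff[OF cont] by simp
  then show ?thesis
    using assms(4) by simp
qed

lemma point_val_h1_rep:
  assumes "h1_rep u U g" "x \<in> {0..2}"
  shows "point_val u x = U x"
proof -
  have U: "continuous_on {0..2} U" and u: "u = abs_L2 U"
    using assms is_prim_continuous by (auto simp: h1_rep_def)
  have AE: "AE t in leb02. rep_L2 u t = U t"
    unfolding u by (intro rep_abs_L2 square_int_continuous U)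
  show ?thesis
    unfolding point_val_def
  proof (rule the_equality)
    show "\<exists>w. continuous_on {0..2} w \<and> (AE t in leb02. rep_L2 u t = w t) \<and> U x = w x"
      using U AE by blast
    fix z assume "\<exists>w. continuous_on {0..2} w \<and> (AE t in leb02. rep_L2 u t = w t) \<and> z = w x"
    then obtain w where w: "continuous_on {0..2} w" "AE t in leb02. rep_L2 u t = w t" "z = w x"
      by blast
    have "AE t in leb02. w t = U t"
      using w(2) AE by eventually_elim simp
    then show "z = U x"
      using continuous_AE_eq[OF w(1) U _ assms(2)] w(3) by simp
  qed
qed

text \<open>Subtracting from u the indefinite integral of its weak derivative leaves a function with
  weak derivative 0, hence a constant a.e.; adding the constant back gives the continuous
  representative.\<close>

lemma H1_h1_rep:
  assumes "u \<in> H1"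
  obtains U g where "h1_rep u U g"
proof -
  obtain g where g: "has_weak_deriv u g"
    using assms by (auto simp: H1_def)
  define V where "V x = integral {0..x} (rep_L2 g)" for x
  have V: "is_prim V (rep_L2 g)"
    unfolding V_def by (intro is_prim_integral square_int_imp_integrable rep_L2)
  have u_int: "integrable leb02 (rep_L2 u)"
    by (intro square_int_imp_integrable rep_L2)
  have V_int: "integrable leb02 V"
    by (intro integrable_leb02_continuous is_prim_continuous[OF V])
  obtain c where c: "AE x in leb02. rep_L2 u x - V x = c"
  proof (rule AE_const_if_weak_deriv_zero)
    show "integrable leb02 (\<lambda>x. rep_L2 u x - V x)"
      using u_int V_int by simp
    fix \<phi> assume \<phi>: "test_fun \<phi>"
    have "continuous_on {0..2} (\<lambda>x. complex_of_real (deriv \<phi> x))"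
      using \<phi> by (auto simp: test_fun_iff intro!: continuous_intros smooth_fun_continuous_on smooth_fun_deriv)
    from integrable_leb02_mult_continuous[OF V_int this]
    have "integrable leb02 (\<lambda>x. V x * of_real (deriv \<phi> x))"
      by (simp add: mult.commute)
    then show "(LINT x|leb02. (rep_L2 u x - V x) * of_real (deriv \<phi> x)) = 0"
      using is_prim_test[OF V \<phi>] g \<phi>
      by (simp add: left_diff_distrib integrable_rep_L2_test test_fun_iff smooth_fun_deriv has_weak_deriv_def)
  qed
  define U where "U x = V x + c" for x
  have U: "is_prim U (rep_L2 g)"
    unfolding U_def using is_prim_add[OF V is_prim_const[of c]] by simp
  have "AE x in leb02. rep_L2 u x = U x"
    using c by eventually_elim (auto simp: U_def algebra_simps)
  then have "u = abs_L2 U"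
    using abs_L2_eq_iff[OF rep_L2 square_int_continuous[OF is_prim_continuous[OF U]], of u]
    by (simp add: abs_rep_L2)
  then have "h1_rep u U (rep_L2 g)"
    using U by (simp add: h1_rep_def rep_L2)
  then show ?thesis
    by (rule that)
qed

lemma H_space_iff: "u \<in> H_space \<longleftrightarrow> (\<exists>U g. h1_rep u U g \<and> U 0 = 0)"
proof
  assume u: "u \<in> H_space"
  then obtain U g where "h1_rep u U g"
    by (auto simp: H_space_def elim: H1_h1_rep)
  then show "\<exists>U g. h1_rep u U g \<and> U 0 = 0"
    using u point_val_h1_rep[of u U g 0] by (auto simp: H_space_def)
next
  assume "\<exists>U g. h1_rep u U g \<and> U 0 = 0"
  then obtain U g where Ug: "h1_rep u U g" "U 0 = 0"
    by blast
  then show "u \<in> H_space"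
    using has_weak_deriv_h1_rep[OF Ug(1)] point_val_h1_rep[OF Ug(1), of 0]
    by (auto simp: H_space_def H1_def)
qed

lemma cinner_abs_L2:
  assumes "square_int f" "square_int g"
  shows "cinner_L2 (abs_L2 f) (abs_L2 g) = (LINT x|leb02. f x * cnj (g x))"
  using assms by (intro cinner_L2.abs_eq) (auto simp: eq_onp_def)

section \<open>The Helmholtz form\<close>

definition refraction :: "complex \<Rightarrow> real \<Rightarrow> complex" where
  "refraction y x = 1 - (1 / 2 + y) * indicator {0..1} x"

lemma borel_measurable_refraction: "refraction y \<in> borel_measurable leb02"
  unfolding refraction_def by (intro borel_measurable_leb02) measurable

lemma integrable_refraction:
  assumes "continuous_on {0..2} q"
  shows "integrable leb02 (\<lambda>x. refraction y x * q x)"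
proof (rule integrable_leb02_mult_bounded[OF integrable_leb02_continuous[OF assms] borel_measurable_refraction])
  show "norm (refraction y x) \<le> 1 + norm (1 / 2 + y)" for x
    unfolding refraction_def by (rule order_trans[OF norm_triangle_ineq4]) (auto simp: indicator_def)
qed

lemma helmholtz_form_h1_rep:
  assumes u: "h1_rep u U g" and v: "h1_rep v V h"
  shows "helmholtz_form k y u v =
    (LINT x|leb02. of_real (1 / k\<^sup>2) * g x * cnj (h x) - refraction y x * U x * cnj (V x))
      - \<i> * of_real (1 / k) * U 2 * cnj (V 2)"
proof -
  have sq: "square_int U" "square_int g" "square_int V" "square_int h"
    using u v is_prim_continuous square_int_continuous by (auto simp: h1_rep_def)
  have eqs: "u = abs_L2 U" "v = abs_L2 V" "weak_deriv u = abs_L2 g" "weak_deriv v = abs_L2 h"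
    using u v weak_deriv_h1_rep by (auto simp: h1_rep_def)
  have m: "f \<in> borel_measurable leb02" "(\<lambda>x. cnj (f x)) \<in> borel_measurable leb02" if "square_int f" for f
    using that square_int_cnj[OF that] by (auto simp: square_int_def)
  note [measurable] = sq[THEN m(1)] sq[THEN m(2)] m[OF rep_L2] borel_measurable_refraction[unfolded refraction_def]
  have "(LINT x|leb02. of_real (1 / k\<^sup>2) * rep_L2 (weak_deriv u) x * cnj (rep_L2 (weak_deriv v) x)
        - (1 - (1 / 2 + y) * indicator {0..1} x) * rep_L2 u x * cnj (rep_L2 v x)) =
      (LINT x|leb02. of_real (1 / k\<^sup>2) * g x * cnj (h x) - refraction y x * U x * cnj (V x))"
    unfolding eqs(3,4) unfolding eqs(1,2) refraction_def
  proof (rule integral_cong_AE)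
    show "AE x in leb02. of_real (1 / k\<^sup>2) * rep_L2 (abs_L2 g) x * cnj (rep_L2 (abs_L2 h) x)
          - (1 - (1 / 2 + y) * indicator {0..1} x) * rep_L2 (abs_L2 U) x * cnj (rep_L2 (abs_L2 V) x) =
        of_real (1 / k\<^sup>2) * g x * cnj (h x) - (1 - (1 / 2 + y) * indicator {0..1} x) * U x * cnj (V x)"
      using sq[THEN rep_abs_L2] by eventually_elim simp
  qed measurable
  then show ?thesis
    using point_val_h1_rep[OF u, of 2] point_val_h1_rep[OF v, of 2]
    by (simp add: helmholtz_form_def)
qed

text \<open>\<open>W\<close> solves $PW = -r$ with the outgoing condition at $2$; nothing is required at $0$.\<close>

definition outgoing :: "real \<Rightarrow> complex \<Rightarrow> (real \<Rightarrow> complex) \<Rightarrow> (real \<Rightarrow> complex) \<Rightarrow> (real \<Rightarrow> complex) \<Rightarrow> bool" where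
  "outgoing k y W W1 r \<longleftrightarrow> is_prim W W1 \<and> is_prim W1 (\<lambda>x. - of_real (k\<^sup>2) * (refraction y x * W x + r x)) \<and>
     W1 2 = \<i> * of_real k * W 2"

text \<open>Integration by parts moves the derivative from V to \<open>W1\<close>. The boundary term
  at 0 disappears with V 0, and at 2 the outgoing condition makes it cancel the boundary term of the
  form. The identity carries no conjugates, so it serves both arguments of the sesquilinear form
  once one function is conjugated.\<close>

lemma outgoing_duality:
  assumes W: "outgoing k y W W1 r" and k: "k \<noteq> 0" and V: "is_prim V h" "V 0 = 0"
  shows "(LINT x|leb02. of_real (1 / k\<^sup>2) * h x * W1 x - refraction y x * V x * W x) - \<i> * of_real (1 / k) * V 2 * W 2
    = (LINT x|leb02. V x * r x)"
proof -
  have W_prim: "is_prim W W1" and W1_prim: "is_prim W1 (\<lambda>x. - of_real (k\<^sup>2) * (refraction y x * W x + r x))"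
    and W2: "W1 2 = \<i> * of_real k * W 2"
    using W by (auto simp: outgoing_def)
  have cont: "continuous_on {0..2} V" "continuous_on {0..2} W" "continuous_on {0..2} W1"
    using is_prim_continuous W_prim W1_prim V by blast+
  have hW1: "integrable leb02 (\<lambda>x. h x * W1 x)"
    using integrable_leb02_mult_continuous[OF is_primD(1)[OF V(1)] cont(3)] by (simp add: mult.commute)
  have nVW: "integrable leb02 (\<lambda>x. refraction y x * V x * W x)"
    using integrable_refraction[of "\<lambda>x. V x * W x"] cont by (simp add: mult.assoc continuous_on_mult)
  \<comment> \<open>Integrability of V r is extracted from that of the derivative of
    \<open>W1\<close>, after dividing out - k^2.\<close>
  have "(\<lambda>x. - inverse (complex_of_real (k\<^sup>2)) * (V x * (- of_real (k\<^sup>2) * (refraction y x * W x + r x)))) =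
      (\<lambda>x. V x * (refraction y x * W x + r x))"
    using k by (simp add: fun_eq_iff field_simps)
  then have VW': "integrable leb02 (\<lambda>x. V x * (refraction y x * W x + r x))"
    using integrable_mult_right[OF integrable_leb02_mult_continuous[OF is_primD(1)[OF W1_prim] cont(1)],
        of "- inverse (complex_of_real (k\<^sup>2))"]
    by (simp only:)
  have Vr: "integrable leb02 (\<lambda>x. V x * r x)"
  proof -
    have "integrable leb02 (\<lambda>x. V x * (refraction y x * W x + r x) - refraction y x * V x * W x)"
      using VW' nVW by (rule Bochner_Integration.integrable_diff)
    then show ?thesis
      by (simp add: algebra_simps)
  qed
  have "(LINT x|leb02. h x * W1 x) = V 2 * W1 2 - (LINT x|leb02. V x * (- of_real (k\<^sup>2) * (refraction y x * W x + r x)))"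
    using integration_by_parts_prim[OF V(1) W1_prim] V(2) by simp
  also have "(LINT x|leb02. V x * (- of_real (k\<^sup>2) * (refraction y x * W x + r x))) =
      (LINT x|leb02. - of_real (k\<^sup>2) * (refraction y x * V x * W x + V x * r x))"
    by (intro Bochner_Integration.integral_cong) (auto simp: algebra_simps)
  also have "\<dots> = - of_real (k\<^sup>2) * ((LINT x|leb02. refraction y x * V x * W x) + (LINT x|leb02. V x * r x))"
    using nVW Vr by simp
  finally have parts: "(LINT x|leb02. h x * W1 x) = \<i> * of_real k * V 2 * W 2 +
      of_real (k\<^sup>2) * ((LINT x|leb02. refraction y x * V x * W x) + (LINT x|leb02. V x * r x))"
    using W2 by (simp add: algebra_simps)
  have "(LINT x|leb02. of_real (1 / k\<^sup>2) * h x * W1 x - refraction y x * V x * W x) =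
      of_real (1 / k\<^sup>2) * (LINT x|leb02. h x * W1 x) - (LINT x|leb02. refraction y x * V x * W x)"
    using hW1 nVW by (simp add: mult.assoc)
  then show ?thesis
    unfolding parts using k by (simp add: field_simps power2_eq_square)
qed

lemma h1_rep_outgoing:
  assumes "outgoing k y W W1 r"
  shows "h1_rep (abs_L2 W) W W1" "h1_rep (abs_L2 (\<lambda>x. cnj (W x))) (\<lambda>x. cnj (W x)) (\<lambda>x. cnj (W1 x))"
proof -
  have "is_prim W W1" "square_int W1"
    using assms is_prim_continuous square_int_continuous by (auto simp: outgoing_def)
  then show "h1_rep (abs_L2 W) W W1"
    "h1_rep (abs_L2 (\<lambda>x. cnj (W x))) (\<lambda>x. cnj (W x)) (\<lambda>x. cnj (W1 x))"
    by (auto simp: h1_rep_def is_prim_cnj square_int_cnj)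
qed

lemma helmholtz_form_outgoing_left:
  assumes W: "outgoing k y W W1 r" and k: "k \<noteq> 0" and v: "h1_rep v V h" and V0: "V 0 = 0"
  shows "helmholtz_form k y (abs_L2 W) v = (LINT x|leb02. r x * cnj (V x))"
proof -
  have V: "is_prim (\<lambda>x. cnj (V x)) (\<lambda>x. cnj (h x))"
    using v by (intro is_prim_cnj) (simp add: h1_rep_def)
  show ?thesis
    unfolding helmholtz_form_h1_rep[OF h1_rep_outgoing(1)[OF W] v]
    using outgoing_duality[OF W k V] V0 by (simp add: mult.assoc mult.commute mult.left_commute)
qed

text \<open>The second argument enters conjugated, so inserting the conjugate of W restores W
  itself. Thus an outgoing W, tested in this way, solves the adjoint problem; u has to satisfy only
  the condition at 0.\<close>

lemma helmholtz_form_outgoing_right: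
  assumes W: "outgoing k y W W1 r" and k: "k \<noteq> 0" and u: "h1_rep u U g" and U0: "U 0 = 0"
  shows "helmholtz_form k y u (abs_L2 (\<lambda>x. cnj (W x))) = (LINT x|leb02. U x * r x)"
proof -
  have U: "is_prim U g"
    using u by (simp add: h1_rep_def)
  show ?thesis
    unfolding helmholtz_form_h1_rep[OF u h1_rep_outgoing(2)[OF W]]
    using outgoing_duality[OF W k U U0] by simp
qed

lemma well_posedI:
  assumes k: "k \<noteq> 0"
    and ex: "\<And>r. square_int r \<Longrightarrow> \<exists>W W1. outgoing k y W W1 r \<and> W 0 = 0"
  shows "well_posed k y"
  unfolding well_posed_def
proof (intro allI ex_ex1I)
  fix f
  obtain W W1 where W: "outgoing k y W W1 (rep_L2 f)" "W 0 = 0"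
    using ex[OF rep_L2] by blast
  have "helmholtz_form k y (abs_L2 W) v = cinner_L2 f v" if v: "v \<in> H_space" for v
  proof -
    obtain V h where V: "h1_rep v V h" "V 0 = 0"
      using v by (auto simp: H_space_iff)
    have "cinner_L2 (abs_L2 (rep_L2 f)) (abs_L2 V) = (LINT x|leb02. rep_L2 f x * cnj (V x))"
      using V is_prim_continuous square_int_continuous by (intro cinner_abs_L2 rep_L2) (auto simp: h1_rep_def)
    then show ?thesis
      using helmholtz_form_outgoing_left[OF W(1) k V] V(1) by (simp add: abs_rep_L2 h1_rep_def)
  qed
  moreover have "abs_L2 W \<in> H_space"
    using h1_rep_outgoing(1)[OF W(1)] W(2) by (auto simp: H_space_iff)
  ultimately show "\<exists>u. is_solution k y f u"
    by (auto simp: is_solution_def)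
next
  fix f u u' assume sol: "is_solution k y f u" "is_solution k y f u'"
  obtain U g U' g' where U: "h1_rep u U g" "U 0 = 0" "h1_rep u' U' g'" "U' 0 = 0"
    using sol by (auto simp: is_solution_def H_space_iff)
  have cont: "continuous_on {0..2} U" "continuous_on {0..2} U'"
    using U is_prim_continuous by (auto simp: h1_rep_def)
  define r where "r x = cnj (U x - U' x)" for x
  have cr: "continuous_on {0..2} r"
    unfolding r_def using cont by (intro continuous_intros)
  obtain W W1 where W: "outgoing k y W W1 r" "W 0 = 0"
    using ex[OF square_int_continuous[OF cr]] by blast
  have "abs_L2 (\<lambda>x. cnj (W x)) \<in> H_space"
    using h1_rep_outgoing(2)[OF W(1)] W(2) by (auto simp: H_space_iff)
  then have "helmholtz_form k y u (abs_L2 (\<lambda>x. cnj (W x))) = helmholtz_form k y u' (abs_L2 (\<lambda>x. cnj (W x)))"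
    using sol by (simp add: is_solution_def)
  then have "(LINT x|leb02. U x * r x) = (LINT x|leb02. U' x * r x)"
    using helmholtz_form_outgoing_right[OF W(1) k] U by simp
  moreover have "integrable leb02 (\<lambda>x. U x * r x)" "integrable leb02 (\<lambda>x. U' x * r x)"
    using cont cr by (auto intro!: integrable_leb02_continuous continuous_intros)
  ultimately have "(LINT x|leb02. (U x - U' x) * r x) = 0"
    by (simp add: left_diff_distrib)
  then have "(LINT x|leb02. (U x - U' x) * cnj (U x - U' x)) = 0"
    unfolding r_def .
  moreover have "(\<lambda>x. (U x - U' x) * cnj (U x - U' x)) = (\<lambda>x. complex_of_real ((cmod (U x - U' x))\<^sup>2))"
    by (simp only: complex_norm_square)
  ultimately have "(LINT x|leb02. (cmod (U x - U' x))\<^sup>2) = 0"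
    by (simp only: integral_complex_of_real of_real_eq_0_iff)
  moreover have "continuous_on {0..2} (\<lambda>x. (cmod (U x - U' x))\<^sup>2)"
    using cont by (intro continuous_intros)
  ultimately have "\<forall>x\<in>{0..2}. U x = U' x"
    using integralL_eq_0_iff[of 0 2 "\<lambda>x. (cmod (U x - U' x))\<^sup>2"] by simp
  then have "AE x in leb02. U x = U' x"
    by (intro AE_I2) simp
  then show "u = u'"
    using U abs_L2_eq_iff[of U U'] square_int_continuous cont by (auto simp: h1_rep_def)
qed

text \<open>Variation of constants: \<phi> respects the condition at 0 and \<psi> the one at 2. With
  \<open>A\<close> integrated from 0 and \<open>B\<close> up to 2, W is a multiple of \<phi> at 0
  and of \<psi> at 2, so it inherits both conditions. In W' the terms with A' and B' cancel; in W''
  they combine to the Wronskian times r.\<close>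

lemma outgoing_green:
  assumes \<psi>: "outgoing k y \<psi> \<psi>1 (\<lambda>_. 0)"
    and \<phi>: "is_prim \<phi> \<phi>1" "is_prim \<phi>1 (\<lambda>x. - of_real (k\<^sup>2) * (refraction y x * \<phi> x))" "\<phi> 0 = 0"
    and wronskian: "\<phi> 1 * \<psi>1 1 - \<phi>1 1 * \<psi> 1 \<noteq> 0"
    and r: "integrable leb02 r"
  shows "\<exists>W W1. outgoing k y W W1 r \<and> W 0 = 0"
proof -
  have \<psi>p: "is_prim \<psi> \<psi>1" "is_prim \<psi>1 (\<lambda>x. - of_real (k\<^sup>2) * (refraction y x * \<psi> x))"
    and \<psi>2: "\<psi>1 2 = \<i> * of_real k * \<psi> 2"
    using \<psi> by (auto simp: outgoing_def)
  define w where "w = \<phi> 1 * \<psi>1 1 - \<phi>1 1 * \<psi> 1"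
  \<comment> \<open>The Wronskian has derivative 0, so its value at the interface x = 1, where it is
    easy to compute, decides everything.\<close>
  have wp: "is_prim (\<lambda>x. \<phi> x * \<psi>1 x - \<phi>1 x * \<psi> x) (\<lambda>_. 0)"
    by (rule is_prim_cong[OF is_prim_diff[OF is_prim_mult[OF \<phi>(1) \<psi>p(2)] is_prim_mult[OF \<phi>(2) \<psi>p(1)]]])
      (auto simp: algebra_simps)
  have const: "\<phi> x * \<psi>1 x - \<phi>1 x * \<psi> x = \<phi> 0 * \<psi>1 0 - \<phi>1 0 * \<psi> 0"
    if "x \<in> {0..2}" for x
    using is_primD(2)[OF wp that] by simp
  have w: "\<phi> x * \<psi>1 x - \<phi>1 x * \<psi> x = w" if "x \<in> {0..2}" for x
    unfolding w_def using const[OF that] const[of 1] by simp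
  have cont: "continuous_on {0..2} \<phi>" "continuous_on {0..2} \<psi>"
    using is_prim_continuous \<phi> \<psi>p by blast+
  define A where "A x = integral {0..x} (\<lambda>t. \<phi> t * r t)" for x
  define B where "B x = integral {0..2} (\<lambda>t. \<psi> t * r t) - integral {0..x} (\<lambda>t. \<psi> t * r t)" for x
  have A: "is_prim A (\<lambda>x. \<phi> x * r x)"
    unfolding A_def by (intro is_prim_integral integrable_leb02_mult_continuous r cont)
  have B: "is_prim B (\<lambda>x. 0 - \<psi> x * r x)"
    unfolding B_def by (intro is_prim_diff is_prim_const is_prim_integral integrable_leb02_mult_continuous r cont)
  define c where "c = - of_real (k\<^sup>2) / w"
  define W where "W x = c * (\<psi> x * A x + \<phi> x * B x)" for x
  define W1 where "W1 x = c * (\<psi>1 x * A x + \<phi>1 x * B x)" for x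
  have "is_prim W W1"
    unfolding W_def W1_def
    by (rule is_prim_cong[OF is_prim_cmult[OF is_prim_add[OF is_prim_mult[OF \<psi>p(1) A] is_prim_mult[OF \<phi>(1) B]]]])
      (auto simp: algebra_simps)
  moreover have "is_prim W1 (\<lambda>x. - of_real (k\<^sup>2) * (refraction y x * W x + r x))"
  proof (rule is_prim_cong[OF is_prim_cmult[OF is_prim_add[OF is_prim_mult[OF \<psi>p(2) A] is_prim_mult[OF \<phi>(2) B]]]])
    fix x :: real assume x: "x \<in> {0..2}"
    have cw: "c * w = - of_real (k\<^sup>2)"
      using wronskian by (simp add: c_def w_def)
    have "c * (- of_real (k\<^sup>2) * (refraction y x * \<psi> x) * A x + \<psi>1 x * (\<phi> x * r x) +
        (- of_real (k\<^sup>2) * (refraction y x * \<phi> x) * B x + \<phi>1 x * (0 - \<psi> x * r x))) =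
      - of_real (k\<^sup>2) * (refraction y x * W x) + c * (\<phi> x * \<psi>1 x - \<phi>1 x * \<psi> x) * r x"
      by (simp add: W_def algebra_simps)
    also have "\<dots> = - of_real (k\<^sup>2) * (refraction y x * W x) + (c * w) * r x"
      by (simp add: w[OF x])
    also have "\<dots> = - of_real (k\<^sup>2) * (refraction y x * W x + r x)"
      unfolding cw by (simp add: algebra_simps)
    finally show "c * (- of_real (k\<^sup>2) * (refraction y x * \<psi> x) * A x + \<psi>1 x * (\<phi> x * r x) +
        (- of_real (k\<^sup>2) * (refraction y x * \<phi> x) * B x + \<phi>1 x * (0 - \<psi> x * r x))) =
      - of_real (k\<^sup>2) * (refraction y x * W x + r x)" .
  qed (simp add: W1_def)
  moreover have "W1 2 = \<i> * of_real k * W 2"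
    by (simp add: W_def W1_def B_def \<psi>2)
  moreover have "W 0 = 0"
    using \<phi>(3) by (simp add: W_def A_def)
  ultimately show ?thesis
    unfolding outgoing_def by blast
qed

section \<open>Explicit solutions of the homogeneous two-layer equation\<close>

text \<open>Solves $q'' = -\kappa^2 q$ with $q(1) = a$ and $q'(1) = b$, so that pieces with equal $a$ and $b$ match
  at the interface $x = 1$.\<close>

definition wave :: "complex \<Rightarrow> complex \<Rightarrow> complex \<Rightarrow> real \<Rightarrow> complex" where
  "wave \<kappa> a b x = a * cos (\<kappa> * of_real (x - 1)) + b / \<kappa> * sin (\<kappa> * of_real (x - 1))"

lemma wave_deriv:
  assumes "\<kappa> \<noteq> 0"
  shows "(wave \<kappa> a b has_vector_derivative wave \<kappa> b (- \<kappa>\<^sup>2 * a) x) (at x)"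
proof -
  have "((\<lambda>z. a * cos (\<kappa> * (z - 1)) + b / \<kappa> * sin (\<kappa> * (z - 1))) has_field_derivative
      wave \<kappa> b (- \<kappa>\<^sup>2 * a) x) (at (of_real x))"
    using assms by (auto intro!: derivative_eq_intros simp: wave_def power2_eq_square)
  from has_vector_derivative_real_field[OF this] show ?thesis
    by (simp add: wave_def[abs_def])
qed

lemma wave_continuous: "continuous_on S (wave \<kappa> a b)"
  unfolding wave_def[abs_def] by (intro continuous_intros)

lemma wave_1: "wave \<kappa> a b 1 = a"
  by (simp add: wave_def)

definition layered_wave :: "complex \<Rightarrow> real \<Rightarrow> complex \<Rightarrow> complex \<Rightarrow> real \<Rightarrow> complex" where
  "layered_wave \<kappa> k a b x = (if x \<le> 1 then wave \<kappa> a b x else wave (of_real k) a b x)"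

text \<open>Differentiating a wave with data a, b at x = 1 gives the wave with data b, - \<kappa>^2
  a; the two pieces again agree at the interface.\<close>

definition layered_wave_deriv :: "complex \<Rightarrow> real \<Rightarrow> complex \<Rightarrow> complex \<Rightarrow> real \<Rightarrow> complex" where
  "layered_wave_deriv \<kappa> k a b x =
     (if x \<le> 1 then wave \<kappa> b (- \<kappa>\<^sup>2 * a) x else wave (of_real k) b (- (of_real k)\<^sup>2 * a) x)"

text \<open>Only the values at 1 have to match. Different slopes b and b' are allowed because the
  second application is to the derivative of a layered wave, whose slope jumps from - \<kappa>^2 a
  to - k^2 a.\<close>

lemma is_prim_piecewise_wave:
  assumes "\<kappa> \<noteq> 0" "\<kappa>' \<noteq> 0"
    and g: "integrable leb02 (\<lambda>x. if x \<le> 1 then wave \<kappa> b (- \<kappa>\<^sup>2 * a) x else wave \<kappa>' b' (- \<kappa>'\<^sup>2 * a) x)"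
  shows "is_prim (\<lambda>x. if x \<le> 1 then wave \<kappa> a b x else wave \<kappa>' a b' x)
    (\<lambda>x. if x \<le> 1 then wave \<kappa> b (- \<kappa>\<^sup>2 * a) x else wave \<kappa>' b' (- \<kappa>'\<^sup>2 * a) x)"
proof (rule is_prim_FTC[of "{1}"])
  show "continuous_on {0..2} (\<lambda>x. if x \<le> 1 then wave \<kappa> a b x else wave \<kappa>' a b' x)"
    by (rule continuous_on_cases_le) (auto simp: wave_1 intro: wave_continuous continuous_intros)
  fix x :: real assume x: "x \<in> {0<..<2} - {1}"
  show "((\<lambda>x. if x \<le> 1 then wave \<kappa> a b x else wave \<kappa>' a b' x) has_vector_derivative
      (if x \<le> 1 then wave \<kappa> b (- \<kappa>\<^sup>2 * a) x else wave \<kappa>' b' (- \<kappa>'\<^sup>2 * a) x)) (at x)"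
  proof (cases "x < 1")
    case True
    then show ?thesis
      using has_vector_derivative_transform_within_open[OF wave_deriv[OF assms(1)], where S = "{..<1}"] by auto
  next
    case False
    then show ?thesis
      using x has_vector_derivative_transform_within_open[OF wave_deriv[OF assms(2)], where S = "{1<..}"] by auto
  qed
qed (use g in auto)

lemma layered_wave_prim:
  assumes "\<kappa> \<noteq> 0" "k \<noteq> 0" "\<kappa>\<^sup>2 = of_real (k\<^sup>2) * (1 / 2 - y)"
  shows "is_prim (layered_wave \<kappa> k a b) (layered_wave_deriv \<kappa> k a b)"
    "is_prim (layered_wave_deriv \<kappa> k a b) (\<lambda>x. - of_real (k\<^sup>2) * (refraction y x * layered_wave \<kappa> k a b x))"
proof -
  have cont: "continuous_on {0..2} (layered_wave \<kappa> k a b)" "continuous_on {0..2} (layered_wave_deriv \<kappa> k a b)"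
    unfolding layered_wave_def[abs_def] layered_wave_deriv_def[abs_def]
    by (rule continuous_on_cases_le; auto simp: wave_1 intro: wave_continuous continuous_intros)+
  show p: "is_prim (layered_wave \<kappa> k a b) (layered_wave_deriv \<kappa> k a b)"
    using is_prim_piecewise_wave[of \<kappa> "of_real k" b a b] assms integrable_leb02_continuous[OF cont(2)]
    by (simp add: layered_wave_def[abs_def] layered_wave_deriv_def[abs_def])
  have w2: "wave \<kappa> (- \<kappa>\<^sup>2 * a) (- \<kappa>\<^sup>2 * b) x = - \<kappa>\<^sup>2 * wave \<kappa> a b x" for \<kappa> x
    by (simp add: wave_def algebra_simps)
  have eq: "(if x \<le> 1 then wave \<kappa> (- \<kappa>\<^sup>2 * a) (- \<kappa>\<^sup>2 * b) x
        else wave (of_real k) (- (of_real k)\<^sup>2 * a) (- (of_real k)\<^sup>2 * b) x) =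
      - of_real (k\<^sup>2) * (refraction y x * layered_wave \<kappa> k a b x)" if "x \<in> {0..2}" for x
    unfolding w2 using that assms(3) by (auto simp: refraction_def layered_wave_def indicator_def)
  have int: "integrable leb02 (\<lambda>x. - of_real (k\<^sup>2) * (refraction y x * layered_wave \<kappa> k a b x))"
    using integrable_refraction[OF cont(1)] by simp
  have "integrable leb02 (\<lambda>x. if x \<le> 1 then wave \<kappa> (- \<kappa>\<^sup>2 * a) (- \<kappa>\<^sup>2 * b) x
        else wave (of_real k) (- (of_real k)\<^sup>2 * a) (- (of_real k)\<^sup>2 * b) x)"
    by (subst Bochner_Integration.integrable_cong[OF refl eq]) (use int in auto)
  from is_prim_piecewise_wave[OF assms(1) _ this]
  have "is_prim (layered_wave_deriv \<kappa> k a b) (\<lambda>x. if x \<le> 1 then wave \<kappa> (- \<kappa>\<^sup>2 * a) (- \<kappa>\<^sup>2 * b) x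
        else wave (of_real k) (- (of_real k)\<^sup>2 * a) (- (of_real k)\<^sup>2 * b) x)"
    using assms(2) by (simp add: layered_wave_deriv_def[abs_def])
  then show "is_prim (layered_wave_deriv \<kappa> k a b) (\<lambda>x. - of_real (k\<^sup>2) * (refraction y x * layered_wave \<kappa> k a b x))"
    using eq by (rule is_prim_cong) auto
qed

section \<open>Resonances\<close>

text \<open>With data 1 and i k at the interface, the wave on [1,2] is exp(i k (x - 1)).\<close>

lemma outgoing_layered_wave:
  assumes "\<kappa> \<noteq> 0" "k \<noteq> 0" "\<kappa>\<^sup>2 = of_real (k\<^sup>2) * (1 / 2 - y)"
  shows "outgoing k y (layered_wave \<kappa> k 1 (\<i> * of_real k)) (layered_wave_deriv \<kappa> k 1 (\<i> * of_real k)) (\<lambda>_. 0)"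
  using layered_wave_prim[OF assms] assms(2)
  by (simp add: outgoing_def layered_wave_def[of _ _ _ _ 2] layered_wave_deriv_def[of _ _ _ _ 2] wave_def algebra_simps power2_eq_square)

lemma well_posed_if_not_resonant:
  assumes \<kappa>: "\<kappa> \<noteq> 0" "k \<noteq> 0" "\<kappa>\<^sup>2 = of_real (k\<^sup>2) * (1 / 2 - y)"
    and nonres: "\<kappa> * cos \<kappa> \<noteq> \<i> * of_real k * sin \<kappa>"
  shows "well_posed k y"
proof (rule well_posedI[OF \<kappa>(2)])
  fix r assume "square_int r"
  then have r: "integrable leb02 r"
    by (rule square_int_imp_integrable)
  show "\<exists>W W1. outgoing k y W W1 r \<and> W 0 = 0"
  \<comment> \<open>These data make the layer part equal to sin (\<kappa> x), which vanishes at 0.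
    The Wronskian at 1 is then i k sin \<kappa> - \<kappa> cos \<kappa>.\<close>
  proof (rule outgoing_green[OF outgoing_layered_wave[OF \<kappa>] layered_wave_prim[OF \<kappa>, of "sin \<kappa>" "\<kappa> * cos \<kappa>"] _ _ r])
    show "layered_wave \<kappa> k (sin \<kappa>) (\<kappa> * cos \<kappa>) 0 = 0"
      using \<kappa> by (simp add: layered_wave_def wave_def)
    show "layered_wave \<kappa> k (sin \<kappa>) (\<kappa> * cos \<kappa>) 1 * layered_wave_deriv \<kappa> k 1 (\<i> * of_real k) 1 -
        layered_wave_deriv \<kappa> k (sin \<kappa>) (\<kappa> * cos \<kappa>) 1 * layered_wave \<kappa> k 1 (\<i> * of_real k) 1 \<noteq> 0"
      using nonres by (simp add: layered_wave_def layered_wave_deriv_def wave_1 mult.commute mult.left_commute)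
  qed
qed

text \<open>At y = 0 the wave number in the layer is 2 \<pi> m, so the resonance function
  \<open>D\<close> equals 2 \<pi> m there and stays nonzero nearby by continuity. The principal
  square root is continuous at 1/2, off its branch cut.\<close>

lemma eventually_well_posed:
  assumes "m > 0" and k: "k = 2 * pi * real m * sqrt 2"
  shows "\<forall>\<^sub>F y in nhds 0. well_posed k y"
proof -
  define \<kappa> where "\<kappa> y = of_real k * csqrt (1 / 2 - y)" for y
  have k0: "k > 0"
    using assms by simp
  have k2: "k / sqrt 2 = 2 * pi * real m"
    using k by simp
  have "csqrt (1 / 2) = of_real (1 / sqrt 2)"
    by (rule csqrt_unique) (simp_all add: power_divide flip: of_real_power)
  then have \<kappa>0: "\<kappa> 0 = of_real (2 * pi * real m)"
    unfolding \<kappa>_def k2[symmetric] by simp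
  have cont: "isCont \<kappa> 0"
    unfolding \<kappa>_def[abs_def] by (intro continuous_intros isCont_csqrt') (auto simp: complex_nonpos_Reals_iff)
  define D where "D y = \<kappa> y * cos (\<kappa> y) - \<i> * of_real k * sin (\<kappa> y)" for y
  have cont': "isCont D 0"
    unfolding D_def[abs_def] using cont by (intro continuous_intros isCont_cos' isCont_sin')
  have sc: "sin (complex_of_real (2 * pi * real m)) = 0" "cos (complex_of_real (2 * pi * real m)) = 1"
    using sin_npi[of "2 * m"] cos_npi[of "2 * m"]
    by (simp_all add: sin_of_real cos_of_real mult.commute mult.left_commute del: of_real_mult)
  have "(\<kappa> \<longlongrightarrow> \<kappa> 0) (nhds 0)"
    using cont by (simp only: isCont_def tendsto_at_iff_tendsto_nhds)
  then have "\<forall>\<^sub>F y in nhds 0. \<kappa> y \<noteq> 0"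
    by (rule tendsto_imp_eventually_ne) (use \<kappa>0 assms(1) in simp)
  moreover have "(D \<longlongrightarrow> D 0) (nhds 0)"
    using cont' by (simp only: isCont_def tendsto_at_iff_tendsto_nhds)
  then have "\<forall>\<^sub>F y in nhds 0. D y \<noteq> 0"
    by (rule tendsto_imp_eventually_ne) (unfold D_def \<kappa>0 sc, use assms(1) in simp)
  ultimately show ?thesis
  proof eventually_elim
    case (elim y)
    then show ?case
      using k0 by (intro well_posed_if_not_resonant[of "\<kappa> y"]) (auto simp: \<kappa>_def D_def power_mult_distrib)
  qed
qed

section \<open>Scalar coefficients of the operator family\<close>

lemma cinner_L2_eq_inner: "cinner_L2 f g = Complex (f \<bullet> g) (scaleC_L2 (- \<i>) f \<bullet> g)"
proof -
  \<comment> \<open>Im w = Re (-i w), so the real inner product, with its boundedness, recovers both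
    parts.\<close>
  have "Im (cinner_L2 f g) = Re (cinner_L2 (scaleC_L2 (- \<i>) f) g)"
    by transfer (simp add: mult.assoc)
  then show ?thesis
    by (simp add: inner_L2_def complex_eq_iff)
qed

lemma cinner_L2_scaleC: "cinner_L2 (scaleC_L2 c f) g = c * cinner_L2 f g"
  by transfer (simp add: mult.assoc)

lemma bounded_linear_cinner_L2: "bounded_linear (\<lambda>f. cinner_L2 f g)"
proof -
  have "bounded_linear (\<lambda>f. complex_of_real (f \<bullet> g) + \<i> * complex_of_real (scaleC_L2 (- \<i>) f \<bullet> g))"
    by (intro bounded_linear_add bounded_linear_const_mult
        bounded_linear_compose[OF bounded_linear_of_real] bounded_linear_inner_left
        bounded_linear_compose[OF bounded_linear_inner_left] bounded_linear_scaleC_L2)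
  then show ?thesis
    by (simp add: cinner_L2_eq_inner Complex_eq)
qed

text \<open>Pairing with fixed f and g reduces operator-valued continuation to the identity theorem
  for scalar functions.\<close>

lemma op_analytic_on_imp_holomorphic:
  assumes "op_analytic_on F S"
  shows "(\<lambda>y. cinner_L2 (F y f) g) holomorphic_on S"
proof (rule holomorphic_onI)
  fix y assume "y \<in> S"
  then obtain D where D: "(F has_derivative (\<lambda>h. scaleC_op h o\<^sub>L D)) (at y)"
    using assms by (auto simp: op_analytic_on_def)
  have "bounded_linear (\<lambda>T::L2 \<Rightarrow>\<^sub>L L2. cinner_L2 (T f) g)"
    by (rule bounded_linear_compose[OF bounded_linear_cinner_L2 blinfun.bounded_linear_left])
  from bounded_linear.has_derivative[OF this D]
  have "((\<lambda>y. cinner_L2 (F y f) g) has_derivative (\<lambda>h. h * cinner_L2 (D f) g)) (at y)"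
    by (simp add: scaleC_op.rep_eq cinner_L2_scaleC)
  then have "((\<lambda>y. cinner_L2 (F y f) g) has_field_derivative cinner_L2 (D f) g) (at y)"
    by (simp add: has_field_derivative_def mult_commute_abs)
  then show "(\<lambda>y. cinner_L2 (F y f) g) field_differentiable at y within S"
    using field_differentiable_at_within field_differentiable_def by blast
qed

lemma solution_op_outgoing:
  assumes wp: "well_posed k y" and k: "k \<noteq> 0"
    and W: "outgoing k z W W1 (\<lambda>_. 0)" "W 0 = 0"
  shows "(y - z) * cinner_L2 (solution_op k y f) (abs_L2 (\<lambda>x. cnj (indicator {0..1} x * W x))) =
    cinner_L2 f (abs_L2 (\<lambda>x. cnj (W x)))"
proof -
  define u where "u = solution_op k y f"
  have "is_solution k y f u"
    unfolding u_def solution_op_def by (rule theI'[OF wp[unfolded well_posed_def, rule_format]])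
  moreover have "abs_L2 (\<lambda>x. cnj (W x)) \<in> H_space"
    using h1_rep_outgoing(2)[OF W(1)] W(2) by (auto simp: H_space_iff)
  ultimately have u: "u \<in> H_space" and
    form: "helmholtz_form k y u (abs_L2 (\<lambda>x. cnj (W x))) = cinner_L2 f (abs_L2 (\<lambda>x. cnj (W x)))"
    by (auto simp: is_solution_def)
  obtain U g where U: "h1_rep u U g" "U 0 = 0"
    using u by (auto simp: H_space_iff)
  \<comment> \<open>The coefficients for y and z differ by (z - y) on the layer only, so W also
    solves the problem at y, with this difference moved into the source.\<close>
  have Wy: "outgoing k y W W1 (\<lambda>x. (y - z) * (indicator {0..1} x * W x))"
  proof -
    have "refraction y x * W x + (y - z) * (indicator {0..1} x * W x) = refraction z x * W x + 0" for x
      by (simp add: refraction_def algebra_simps)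
    then show ?thesis
      using W(1) by (simp add: outgoing_def)
  qed
  have contU: "continuous_on {0..2} U" and contW: "continuous_on {0..2} W"
    using U(1) W(1) is_prim_continuous by (auto simp: h1_rep_def outgoing_def)
  have "square_int (\<lambda>x. W x * indicator {0..1} x)"
  proof (rule square_int_mult_continuous[OF _ contW])
    have "(indicator {0..1} :: real \<Rightarrow> complex) \<in> borel_measurable leb02"
      by (intro borel_measurable_leb02) measurable
    moreover have "(\<lambda>x::real. (cmod (indicator {0..1} x))\<^sup>2) = indicat_real {0..1}"
      by (auto simp: indicator_def)
    moreover have "integrable leb02 (indicat_real {0..1})"
      using integrable_mult_indicator[OF sets_leb02_atLeastAtMost[of 0 1], of "\<lambda>_. 1::real"] by simp
    ultimately show "square_int (indicator {0..1})"
      unfolding square_int_def by (simp only: simp_thms)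
  qed
  then have "square_int (\<lambda>x. cnj (W x * indicator {0..1} x))"
    by (rule square_int_cnj)
  then have "square_int (\<lambda>x. cnj (indicator {0..1} x * W x))"
    by (simp add: mult.commute)
  then have "cinner_L2 u (abs_L2 (\<lambda>x. cnj (indicator {0..1} x * W x))) =
      (LINT x|leb02. U x * (indicator {0..1} x * W x))"
    using U(1) cinner_abs_L2[OF square_int_continuous[OF contU]] by (simp add: h1_rep_def)
  moreover have "helmholtz_form k y u (abs_L2 (\<lambda>x. cnj (W x))) =
      (y - z) * (LINT x|leb02. U x * (indicator {0..1} x * W x))"
    unfolding helmholtz_form_outgoing_right[OF Wy k U]
    by (simp only: mult.left_commute[of "U _"] integral_mult_right_zero)
  ultimately show ?thesis
    using form by (simp add: u_def)
qed

lemma not_continues_past_resonance: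
  assumes \<kappa>: "\<kappa> \<noteq> 0" "k \<noteq> 0" and res: "\<kappa> * cos \<kappa> = \<i> * of_real k * sin \<kappa>"
    and z: "z = 1 / 2 - \<kappa>\<^sup>2 / of_real (k\<^sup>2)" "cmod z < \<rho>"
    and wp: "\<forall>\<^sub>F y in nhds 0. well_posed k y"
  shows "\<not> continues_to_ball k \<rho>"
proof
  assume "continues_to_ball k \<rho>"
  then obtain F where F: "op_analytic_on F (ball 0 \<rho>)"
    and agree: "\<forall>\<^sub>F y in nhds 0. blinfun_apply (F y) = solution_op k y"
    by (auto simp: continues_to_ball_def)
  define W where "W = layered_wave \<kappa> k 1 (\<i> * of_real k)"
  define f where "f = abs_L2 (\<lambda>x. cnj (W x))"
  define g where "g = abs_L2 (\<lambda>x. cnj (indicator {0..1} x * W x))"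
  have "\<kappa>\<^sup>2 = of_real (k\<^sup>2) * (1 / 2 - z)"
    using \<kappa> z by simp
  from outgoing_layered_wave[OF \<kappa> this]
  obtain W1 where W: "outgoing k z W W1 (\<lambda>_. 0)"
    by (auto simp: W_def)
  \<comment> \<open>W 0 = cos \<kappa> - (i k / \<kappa>) sin \<kappa>, so the resonance condition
    is precisely the Dirichlet condition; W 1 = 1 will show that W is not the zero state.\<close>
  have W0: "W 0 = 0" and W_one: "W 1 = 1"
    using res \<kappa> by (auto simp: W_def layered_wave_def wave_1 wave_def field_simps)
  have "\<forall>\<^sub>F y in nhds 0. (y - z) * cinner_L2 (F y f) g = cinner_L2 f f"
    using agree wp
  proof eventually_elim
    case (elim y)
    show ?case
      using solution_op_outgoing[OF elim(2) \<kappa>(2) W W0, of f] elim(1) unfolding f_def g_def by simp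
  qed
  then obtain S where S: "open S" "0 \<in> S" "\<And>y. y \<in> S \<Longrightarrow> (y - z) * cinner_L2 (F y f) g = cinner_L2 f f"
    by (auto simp: eventually_nhds)
  have "0 < \<rho>"
    using z(2) norm_ge_zero[of z] by linarith
  have "(z - z) * cinner_L2 (F z f) g = cinner_L2 f f"
  proof (rule analytic_continuation_open[of "S \<inter> ball 0 \<rho>" "ball 0 \<rho>"
        "\<lambda>y. (y - z) * cinner_L2 (F y f) g" "\<lambda>_. cinner_L2 f f" z])
    show "(\<lambda>y. (y - z) * cinner_L2 (F y f) g) holomorphic_on ball 0 \<rho>"
      by (intro holomorphic_intros op_analytic_on_imp_holomorphic F)
  qed (use S z(2) \<open>0 < \<rho>\<close> in \<open>auto intro!: holomorphic_intros\<close>)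
  then have "f \<bullet> f = 0"
    by (simp add: inner_L2_def)
  then have "f = 0"
    by simp
  have contW: "continuous_on {0..2} (\<lambda>x. cnj (W x))"
    using W is_prim_continuous by (auto simp: outgoing_def intro!: continuous_intros)
  have "AE x in leb02. cnj (W x) = 0"
    using \<open>f = 0\<close> abs_L2_eq_iff[OF square_int_continuous[OF contW] square_int_zero]
    by (simp add: f_def zero_L2_def)
  from continuous_AE_eq[OF contW _ this, of 1] show False
    using W_one by simp
qed

text \<open>The Moebius map sends the unit disc to the right half-plane, away from the branch cut of
  \<open>Ln\<close>. For this s its modulus lies between 3/37 and 37/3, hence between exp(-4) and
  exp 4; with |Im Ln| \<le> \<pi> < 4 the total is at most 8.\<close>

lemma Ln_moebius_bound:
  fixes s :: complex
  assumes s: "cmod s \<le> 17 / 20"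
  shows "(1 + s) / (1 - s) \<notin> \<real>\<^sub>\<le>\<^sub>0" "cmod (Ln ((1 + s) / (1 - s))) \<le> 8"
proof -
  let ?q = "(1 + s) / (1 - s)"
  have ne: "s \<noteq> 1" "s \<noteq> -1"
    using s by auto
  show "?q \<notin> \<real>\<^sub>\<le>\<^sub>0"
  proof
    assume "?q \<in> \<real>\<^sub>\<le>\<^sub>0"
    then obtain t where t: "?q = of_real t" "t \<le> 0"
      by (rule nonpos_Reals_cases)
    have "1 + s = of_real t * (1 - s)"
      using ne t(1) by (simp add: divide_eq_eq)
    then have "s * of_real (1 + t) = of_real (t - 1)"
      by (simp add: algebra_simps)
    then have "cmod s * \<bar>1 + t\<bar> = \<bar>t - 1\<bar>"
      by (metis norm_mult norm_of_real)
    moreover have "cmod s * \<bar>1 + t\<bar> \<le> 17 / 20 * (1 - t)"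
      using s t(2) by (intro mult_mono) auto
    ultimately show False
      using t(2) by simp
  qed
  have b: "3 / 20 \<le> cmod (1 + s)" "cmod (1 + s) \<le> 37 / 20" "3 / 20 \<le> cmod (1 - s)" "cmod (1 - s) \<le> 37 / 20"
    using s norm_triangle_ineq[of 1 s] norm_triangle_ineq4[of 1 s]
      norm_triangle_ineq2[of 1 "- s"] norm_triangle_ineq2[of 1 s] by auto
  have pos: "0 < cmod (1 - s)"
    using ne by simp
  have "1 / 20 \<le> cmod ?q" "cmod ?q \<le> 20"
    using b pos by (simp_all add: norm_divide pos_le_divide_eq pos_divide_le_eq)
  moreover have e: "(20::real) \<le> exp 4"
  proof -
    \<comment> \<open>exp 1 \<ge> 1 + 1 + 1/2, and (5/2)^4 exceeds 20.\<close>
    have "(5 / 2 :: real) ^ 4 \<le> exp 1 ^ 4"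
      using exp_lower_Taylor_quadratic[of "1::real"] by (intro power_mono) simp_all
    also have "exp 1 ^ 4 = exp (4::real)"
      using exp_of_nat_mult[of 4 "1::real"] by simp
    finally show ?thesis
      by (simp add: power4_eq_xxxx)
  qed
  moreover have "exp (- 4 :: real) \<le> 1 / 20"
    using e by (simp add: exp_minus inverse_eq_divide)
  ultimately have "cmod ?q \<le> exp 4" "exp (- 4) \<le> cmod ?q"
    by linarith+
  moreover have q: "?q \<noteq> 0"
    using ne by (simp add: add_eq_0_iff)
  ultimately have "ln (cmod ?q) \<le> ln (exp 4)" "ln (exp (- 4)) \<le> ln (cmod ?q)"
    by (subst ln_le_cancel_iff; simp only: zero_less_norm_iff exp_gt_zero)+
  then have "\<bar>Re (Ln ?q)\<bar> \<le> 4"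
    unfolding Re_Ln[OF q] ln_exp by linarith
  moreover have "\<bar>Im (Ln ?q)\<bar> \<le> pi"
    using mpi_less_Im_Ln[OF q] Im_Ln_le_pi[OF q] by linarith
  ultimately show "cmod (Ln ?q) \<le> 8"
    using cmod_le[of "Ln ?q"] pi_less_4 by linarith
qed

text \<open>Half of the logarithm bound 8 is 4, so \<open>G\<close> maps the ball of radius 4 to
  itself. Brouwer's theorem asks only for continuity of \<open>G\<close>, so no contraction estimate
  is made.\<close>

lemma resonance_exists:
  assumes k: "k = 2 * pi * real m * sqrt 2" "k \<ge> 40"
  obtains \<kappa> where "\<kappa> \<noteq> 0" "\<kappa> * cos \<kappa> = \<i> * of_real k * sin \<kappa>"
    "cmod (1 / 2 - \<kappa>\<^sup>2 / of_real (k\<^sup>2)) \<le> 8 / k"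
proof -
  define s0 where "s0 = 1 / sqrt 2"
  \<comment> \<open>For \<open>\<kappa> = k \<sigma> z = 2 \<pi> m - \<i> z\<close> the resonance condition reads \<open>exp (2 z) = (1 + \<sigma> z) / (1 - \<sigma> z)\<close>.\<close>
  define \<sigma> where "\<sigma> z = of_real s0 - \<i> * z / of_real k" for z
  define G where "G z = Ln ((1 + \<sigma> z) / (1 - \<sigma> z)) / 2" for z
  have s0: "s0 * s0 = 1 / 2" "s0 > 0"
    by (auto simp: s0_def)
  have s0_le: "s0 \<le> 3 / 4"
    by (rule power2_le_imp_le) (use s0 in \<open>simp_all add: power2_eq_square\<close>)
  have s0_ge: "1 / 2 \<le> s0"
    by (rule power2_le_imp_le) (use s0 in \<open>simp_all add: power2_eq_square\<close>)
  have d: "cmod (\<sigma> z - of_real s0) \<le> 4 / k" if "z \<in> cball 0 4" for z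
    using that k(2) by (simp add: \<sigma>_def norm_divide norm_mult divide_right_mono)
  have d': "cmod (\<sigma> z - of_real s0) \<le> 1 / 10" if "z \<in> cball 0 4" for z
    using d[OF that] k(2) by (elim order_trans) (simp add: field_simps)
  \<comment> \<open>17/20 = 3/4 + 1/10: the first bounds 1 / sqrt 2, the second bounds 4 / k and is
    the reason for requiring k \<ge> 40.\<close>
  have \<sigma>_le: "cmod (\<sigma> z) \<le> 17 / 20" if "z \<in> cball 0 4" for z
    using d'[OF that] norm_triangle_sub[of "\<sigma> z" "of_real s0"] s0_le s0(2) by simp
  have cont: "continuous_on (cball 0 4) \<sigma>"
    unfolding \<sigma>_def[abs_def] using k(2) by (intro continuous_intros) auto
  have ne1: "1 - \<sigma> z \<noteq> 0" "1 + \<sigma> z \<noteq> 0" if "z \<in> cball 0 4" for z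
    using \<sigma>_le[OF that] by (auto simp: add_eq_0_iff)
  obtain z where z: "z \<in> cball 0 4" "G z = z"
  proof (rule brouwer)
    show "continuous_on (cball 0 4) G"
      unfolding G_def[abs_def] using Ln_moebius_bound(1)[OF \<sigma>_le] ne1 cont
      by (intro continuous_intros) auto
    show "G \<in> cball 0 4 \<rightarrow> cball 0 4"
      using Ln_moebius_bound(2)[OF \<sigma>_le] by (auto simp: G_def norm_divide)
  qed auto
  define \<kappa> where "\<kappa> = of_real k * \<sigma> z"
  have \<kappa>: "\<kappa> \<noteq> 0"
    using d'[OF z(1)] s0_ge k(2) by (auto simp: \<kappa>_def)
  have "k * s0 = 2 * pi * real m"
    by (simp add: k(1) s0_def)
  then have \<kappa>_eq: "\<kappa> = of_real (2 * pi * real m) - \<i> * z"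
    using k(2) by (simp add: \<kappa>_def \<sigma>_def right_diff_distrib flip: of_real_mult)
  have "exp (\<i> * of_real (2 * pi * real m)) = 1"
    by (auto simp: exp_eq_1 intro!: exI[of _ "int m"])
  moreover have "\<i> * \<kappa> = \<i> * of_real (2 * pi * real m) + z"
    by (simp add: \<kappa>_eq right_diff_distrib flip: mult.assoc)
  ultimately have E: "exp (\<i> * \<kappa>) = exp z"
    by (simp only: exp_add mult_1)
  have "exp z * exp z = (1 + \<sigma> z) / (1 - \<sigma> z)"
  proof -
    have "exp z * exp z = exp (2 * G z)"
      by (simp only: z(2) mult_2 exp_add)
    also have "\<dots> = (1 + \<sigma> z) / (1 - \<sigma> z)"
      using ne1[OF z(1)] by (simp add: G_def)
    finally show ?thesis .
  qed
  then have E2: "exp z * exp z * (1 - \<sigma> z) = 1 + \<sigma> z"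
    using ne1[OF z(1)] by (simp add: eq_divide_eq)
  have res: "\<sigma> z * cos \<kappa> = \<i> * sin \<kappa>"
  proof -
    have c: "cos \<kappa> = (exp z + inverse (exp z)) / 2" and s: "\<i> * sin \<kappa> = (exp z - inverse (exp z)) / 2"
      using E by (simp_all add: cos_exp_eq sin_exp_eq exp_minus diff_divide_distrib)
    have "exp z * (\<sigma> z * (exp z + inverse (exp z)) - (exp z - inverse (exp z))) = 0"
      using E2 by (simp add: algebra_simps)
    then have "\<sigma> z * (exp z + inverse (exp z)) = exp z - inverse (exp z)"
      by (simp only: mult_eq_0_iff exp_not_eq_zero right_minus_eq simp_thms)
    then show ?thesis
      unfolding c s by simp
  qed
  show ?thesis
  proof (rule that[OF \<kappa>])
    show "\<kappa> * cos \<kappa> = \<i> * of_real k * sin \<kappa>"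
      using res by (simp add: \<kappa>_def)
    have "complex_of_real s0 * of_real s0 = 1 / 2"
      using arg_cong[OF s0(1), of complex_of_real] by simp
    moreover have "\<kappa>\<^sup>2 / of_real (k\<^sup>2) = \<sigma> z * \<sigma> z"
      using k(2) by (simp add: \<kappa>_def power2_eq_square)
    ultimately have "1 / 2 - \<kappa>\<^sup>2 / of_real (k\<^sup>2) = of_real s0 * of_real s0 - \<sigma> z * \<sigma> z"
      by simp
    also have "\<dots> = (of_real s0 - \<sigma> z) * (of_real s0 + \<sigma> z)"
      by (simp add: algebra_simps)
    finally have "cmod (1 / 2 - \<kappa>\<^sup>2 / of_real (k\<^sup>2)) = cmod (\<sigma> z - of_real s0) * cmod (of_real s0 + \<sigma> z)"
      by (simp add: norm_mult norm_minus_commute)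
    \<comment> \<open>|s0 + \<sigma> z| \<le> 3/4 + 17/20 < 2; this product is the origin of the
      constant 8.\<close>
    also have "\<dots> \<le> (4 / k) * 2"
      using d[OF z(1)] \<sigma>_le[OF z(1)] s0_le s0(2) norm_triangle_ineq[of "of_real s0" "\<sigma> z"] k(2)
      by (intro mult_mono) auto
    finally show "cmod (1 / 2 - \<kappa>\<^sup>2 / of_real (k\<^sup>2)) \<le> 8 / k"
      by simp
  qed
qed

theorem corollary1p5:
  shows "\<exists>(m\<^sub>0::nat) (C::real). m\<^sub>0 > 0 \<and> C > 0 \<and>
    (\<forall>(m::nat) (k::real). m \<ge> m\<^sub>0 \<longrightarrow> k = 2 * pi * real m * sqrt 2 \<longrightarrow>
       (\<forall>\<^sub>F y in nhds 0. well_posed k y) \<and>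
       (\<forall>\<rho>::real. \<rho> > C / k \<longrightarrow> \<not> continues_to_ball k \<rho>))"
proof -
  have "(\<forall>\<^sub>F y in nhds 0. well_posed k y) \<and> (\<forall>\<rho>>8 / k. \<not> continues_to_ball k \<rho>)"
    if m: "10 \<le> m" and k: "k = 2 * pi * real m * sqrt 2" for m k
  proof -
    have wp: "\<forall>\<^sub>F y in nhds 0. well_posed k y"
      using m by (intro eventually_well_posed[OF _ k]) simp
    \<comment> \<open>The crude bounds \<pi> \<ge> 2, m \<ge> 10 and sqrt 2 \<ge> 1 suffice to reach
      40.\<close>
    have "40 = 2 * 2 * 10 * (1::real)"
      by simp
    also have "\<dots> \<le> 2 * pi * real m * sqrt 2"
      using m pi_ge_two by (intro mult_mono) auto
    finally have k40: "k \<ge> 40"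
      by (simp add: k)
    obtain \<kappa> where \<kappa>: "\<kappa> \<noteq> 0" "\<kappa> * cos \<kappa> = \<i> * of_real k * sin \<kappa>"
      "cmod (1 / 2 - \<kappa>\<^sup>2 / of_real (k\<^sup>2)) \<le> 8 / k"
      using resonance_exists[OF k k40] by blast
    have "\<not> continues_to_ball k \<rho>" if "8 / k < \<rho>" for \<rho>
      using k40 \<kappa>(3) that
      by (intro not_continues_past_resonance[OF \<kappa>(1) _ \<kappa>(2) refl _ wp]) linarith+
    with wp show ?thesis
      by blast
  qed
  then show ?thesis
    by (intro exI[of _ "10::nat"] exI[of _ "8::real"]) simp
qed

end
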